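(* Let $0=t_0<\dots<t_N=T$, $\Omega=C([0,T];\mathbb{R}^{d_Z})$ with canonical process $Z$ and canonical filtration $(\mathcal F_t)$, and $\Pi=(Z_{t_0},\dots,Z_{t_N})$. Let $R$ be a probability measure on $\Omega$ that is grid-compatible (see context), $r:=R\circ\Pi^{-1}$, and let $\mu$ be a probability measure on $(\mathbb{R}^{d_Z})^{N+1}$ with $\mu\ll r$ and $H(\mu\mid r)<\infty$. Let $P$ be a probability measure on $\Omega$ with $P\circ\Pi^{-1}=\mu$. Fix $i\in\{0,\dots,N-1\}$ and disintegrate $$P(d\omega)=P_{\le i}(d\omega_{\le i})\,P_{>i}^{\omega_{\le i}}(d\omega_{>i}),\qquad R(d\omega)=R_{\le i}(d\omega_{\le i})\,R_{>i}^{\Pi_i(\omega)}(d\omega_{>i}).$$ Then $P$ minimises $H(\cdot\mid R)$ among all probability measures on $\Omega$ whose image under $\Pi$ is $\mu$ if and only if the following two conditions hold: (i) the past marginal $P_{\le i}$ minimises $\inf\{H(M\mid R_{\le i}):\ M\circ\Pi_i^{-1}=\mu_i\}$ over probability measures $M$ on the space of paths on $[0,t_i]$; (ii) for $P_{\le i}$-a.e. past $\omega_{\le i}$, the conditional law $P_{>i}^{\omega_{\le i}}$ minimises $$\inf\Bigl\{H\bigl(Q\mid R_{>i}^{\Pi_i(\omega_{\le i})}\bigr):\ Q\circ\Pi_{>i}^{-1}=\mu_{>i}^{\Pi_i(\omega_{\le i})}\Bigr\}$$ over probability measures $Q$ on the space $\Omega_{>i}$ of future paths.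
   Context: $H(P\mid R)=E_P[\log(dP/dR)]$ if $P\ll R$, $+\infty$ otherwise, is relative entropy. Notation: $\Pi_i=(Z_{t_0},\dots,Z_{t_i})$ and $\Pi_{>i}=(Z_{t_{i+1}},\dots,Z_{t_N})$. $\omega_{\le i}$ is the restriction of the path $\omega$ to $[0,t_i]$, $\omega_{>i}$ its restriction to $(t_i,T]$, and $\Omega_{>i}$ is the space of such future paths. Grid-compatibility of $R$: for every $i=0,\dots,N-1$ the conditional law under $R$ of the future path $\omega_{>i}$ given $\mathcal F_{t_i}$ depends on the past only through $\Pi_i$; i.e. there are probability kernels $\mathbf z_i\mapsto R_{>i}^{\mathbf z_i}$ on $\Omega_{>i}$, $\mathbf z_i\in(\mathbb{R}^{d_Z})^{i+1}$, with $R(d\omega_{>i}\mid\mathcal F_{t_i})=R_{>i}^{\Pi_i(\omega)}(d\omega_{>i})$. The target is disintegrated as $\mu(d\mathbf z_N)=\mu_i(d\mathbf z_i)\,\mu_{>i}^{\mathbf z_i}(d\mathbf z_{>i})$, where $\mu_i$ is the law of the first $i+1$ grid coordinates and $\mu_{>i}^{\mathbf z_i}$ the conditional law of the remaining ones. *)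

theory Defs
  imports "HOL-Probability.Probability"
begin

text \<open>Paths on \<open>[0, s]\<close> are extensional functions, so that restriction of paths and
  equality of paths are literal.\<close>

definition cpaths :: "real \<Rightarrow> (real \<Rightarrow> 'a::topological_space) set" where
  "cpaths s = {\<omega> \<in> extensional {0..s}. continuous_on {0..s} \<omega>}"

text \<open>The \<open>\<sigma>\<close>-algebra is the trace of the product \<open>\<sigma>\<close>-algebra, i.e. the one generated by
  the coordinate maps; on \<open>C([0, s])\<close> it is the Borel \<open>\<sigma>\<close>-algebra of uniform convergence.\<close>

definition path_space :: "real \<Rightarrow> (real \<Rightarrow> 'a::topological_space) measure" where
  "path_space s = restrict_space (PiM {0..s} (\<lambda>_. borel)) (cpaths s)"

text \<open>Future paths live on the half-open interval \<open>(s, T]\<close>; only restrictions of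
  continuous paths on \<open>[0, T]\<close> are admitted, so they have a limit at \<open>s\<close>.\<close>

definition future_space :: "real \<Rightarrow> real \<Rightarrow> (real \<Rightarrow> 'a::topological_space) measure" where
  "future_space s T =
     restrict_space (PiM {s<..T} (\<lambda>_. borel)) ((\<lambda>\<omega>. restrict \<omega> {s<..T}) ` cpaths T)"

definition canonical_filtration :: "real \<Rightarrow> real \<Rightarrow> (real \<Rightarrow> 'a::topological_space) measure" where
  "canonical_filtration T s =
     sigma (cpaths T) {{\<omega> \<in> cpaths T. \<omega> u \<in> B} | u B. u \<in> {0..s} \<and> B \<in> sets borel}"

abbreviation coords :: "nat set \<Rightarrow> (nat \<Rightarrow> 'a::topological_space) measure" where
  "coords J \<equiv> PiM J (\<lambda>_. borel)"

text \<open>With index set \<open>{..N}\<close>, \<open>{..i}\<close> and \<open>{i<..N}\<close> this is \<open>\<Pi>\<close>, \<open>\<Pi>\<^sub>i\<close> and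
  \<open>\<Pi>\<^sub>>\<^sub>i\<close>; it applies equally to full, past and future paths.\<close>

definition grid_proj :: "(nat \<Rightarrow> real) \<Rightarrow> nat set \<Rightarrow> (real \<Rightarrow> 'a) \<Rightarrow> (nat \<Rightarrow> 'a)" where
  "grid_proj t J \<omega> = (\<lambda>j\<in>J. \<omega> (t j))"

definition past_law :: "real \<Rightarrow> (real \<Rightarrow> 'a::topological_space) measure \<Rightarrow> (real \<Rightarrow> 'a) measure" where
  "past_law s P = distr P (path_space s) (\<lambda>\<omega>. restrict \<omega> {0..s})"

text \<open>\<open>K\<close> is a regular conditional law of \<open>Y\<close> given \<open>X\<close> under \<open>L\<close>: the joint law of
  \<open>(X, Y)\<close> is \<open>L\<^sub>X(dx) K(x)(dy)\<close>.\<close>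

definition disintegrates ::
  "'w measure \<Rightarrow> 'x measure \<Rightarrow> ('w \<Rightarrow> 'x) \<Rightarrow> 'y measure \<Rightarrow> ('w \<Rightarrow> 'y) \<Rightarrow> ('x \<Rightarrow> 'y measure) \<Rightarrow> bool" where
  "disintegrates L M\<^sub>1 X M\<^sub>2 Y K \<longleftrightarrow>
     K \<in> M\<^sub>1 \<rightarrow>\<^sub>M prob_algebra M\<^sub>2 \<and>
     distr L (M\<^sub>1 \<Otimes>\<^sub>M M\<^sub>2) (\<lambda>\<omega>. (X \<omega>, Y \<omega>)) =
       bind (distr L M\<^sub>1 X) (\<lambda>x. distr (K x) (M\<^sub>1 \<Otimes>\<^sub>M M\<^sub>2) (Pair x))"

definition grid_compatible ::
  "real \<Rightarrow> (nat \<Rightarrow> real) \<Rightarrow> nat \<Rightarrow> (real \<Rightarrow> 'a::topological_space) measure \<Rightarrow> bool" where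
  "grid_compatible T t N R \<longleftrightarrow>
     (\<forall>i<N. \<exists>K \<in> coords {..i} \<rightarrow>\<^sub>M prob_algebra (future_space (t i) T).
        \<forall>B \<in> sets (future_space (t i) T).
          AE \<omega> in R. real_cond_exp R (canonical_filtration T (t i))
              (indicator {\<omega> \<in> space R. restrict \<omega> {t i<..T} \<in> B}) \<omega>
            = measure (K (grid_proj t {..i} \<omega>)) B)"

text \<open>Expectation with values in the extended reals, as positive minus negative part.  The
  Bochner integral (and hence the library's real-valued KL divergence) is \<open>0\<close> when the
  integrand is not integrable, which is wrong for relative entropy.\<close>

definition ext_expectation :: "'w measure \<Rightarrow> ('w \<Rightarrow> real) \<Rightarrow> ereal" where
  "ext_expectation P f =
     enn2ereal (\<integral>\<^sup>+\<omega>. ennreal (f \<omega>) \<partial>P) - enn2ereal (\<integral>\<^sup>+\<omega>. ennreal (- f \<omega>) \<partial>P)"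

text \<open>Note the argument order: \<open>absolutely_continuous R P\<close> means \<open>P << R\<close>, and
  \<open>RN_deriv R P\<close> is \<open>dP/dR\<close>.\<close>

definition rel_entropy :: "'w measure \<Rightarrow> 'w measure \<Rightarrow> ereal" where
  "rel_entropy P R =
     (if absolutely_continuous R P
      then ext_expectation P (\<lambda>\<omega>. ln (enn2real (RN_deriv R P \<omega>))) else \<infinity>)"

definition laws_with_image ::
  "'w measure \<Rightarrow> 'z measure \<Rightarrow> ('w \<Rightarrow> 'z) \<Rightarrow> 'z measure \<Rightarrow> 'w measure set" where
  "laws_with_image S E f \<nu> = {Q \<in> space (prob_algebra S). distr Q E f = \<nu>}"

definition minimises_entropy :: "'w measure set \<Rightarrow> 'w measure \<Rightarrow> 'w measure \<Rightarrow> bool" where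
  "minimises_entropy C R P \<longleftrightarrow> P \<in> C \<and> (\<forall>Q\<in>C. rel_entropy P R \<le> rel_entropy Q R)"

end

theory Submission
  imports Defs
begin

text \<open>Let \<open>h\<close> be the density of \<open>\<mu>\<close> with respect to \<open>r\<close>.  If \<open>Q\<close> has image \<open>\<mu>\<close> under \<open>\<Pi>\<close>,
  then \<open>H(Q | R) = H(\<mu> | r) + H(Q | h(\<Pi>) R)\<close>; since \<open>H(\<mu> | r)\<close> is finite, Gibbs' inequality shows
  that the unique minimiser is \<open>h(\<Pi>) R\<close>.  The same description applies to the past and to almost
  every future problem: with \<open>h\<^sub>1\<close> the density of the past grid marginal, the unique minimisers are
  \<open>h\<^sub>1(\<Pi>\<^sub>i) R\<^sub>\<le>\<^sub>i\<close> and \<open>(h / h\<^sub>1)(\<Pi>\<^sub>i, \<Pi>\<^sub>>\<^sub>i) R\<^sub>>\<^sub>i\<close>.  So the equivalence says that \<open>P = h(\<Pi>) R\<close> iff the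
  two parts of its disintegration have these densities, which is uniqueness of disintegrations.\<close>

section \<open>Entropy minimisers with prescribed image\<close>

text \<open>The delicate points are integrability and null sets. If the least entropy of a problem
  were \<infinity>, every admissible law would be a minimiser, so uniqueness requires an integrable
  log-density in each of the three problems. For the whole problem this is H(\<mu> | r) <
  \<infinity>, because the negative part of a log-density always has finite integral under the
  measure that the density defines. For the past and for almost every future it has to be derived:
  \<open>ln h\<^sub>1\<close> is dominated with the help of \<open>ln x \<le> x - 1\<close>, and
  \<open>ln (h / h\<^sub>1)\<close> is a difference that is then integrated along the kernel.
  Conditional laws are unique only up to null sets that depend on the event tested; a countable
  generator of the future sigma-algebra leaves a single null set. The entropy argument uses no
  continuity of paths. It needs that past and future together generate the path sigma-algebra, that
  grid projections commute with the splitting, and that the reference kernel sees the past only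
  through the grid. The last property makes the marginal density on paths the same function
  \<open>h\<^sub>1\<close> of the past grid as on grid vectors.\<close>

lemma ennreal_pos_finiteE:
  fixes x :: ennreal
  assumes "0 < x" "x < \<top>"
  obtains r where "x = ennreal r" "r > 0"
  using assms by (cases x) auto

lemma ennreal_mult_divide_cancel:
  fixes a b :: ennreal
  assumes "b \<noteq> 0" "b \<noteq> \<top>"
  shows "b * (a / b) = a"
  unfolding ennreal_times_divide mult.commute[of b a] by (rule mult_divide_eq_ennreal[OF assms])

lemma ennreal_mult_divide_le:
  fixes a b :: ennreal
  shows "b * (a / b) \<le> a"
proof (cases "b = 0 \<or> b = \<top>")
  case False
  then show ?thesis using ennreal_mult_divide_cancel by simp
qed auto

text \<open>The weight \<open>h\<close> tames the singularity of the logarithm at 0: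
  \<open>- r * ln r \<le> 1 - r \<le> 1\<close>. Hence the extended expectation that defines the
  entropy never has the form \<infinity> - \<infinity>.\<close>

lemma nn_integral_neg_ln_density_le:
  assumes "prob_space R" and [measurable]: "h \<in> borel_measurable R"
  shows "(\<integral>\<^sup>+x. ennreal (- ln (enn2real (h x))) \<partial>density R h) \<le> 1"
proof -
  \<comment> \<open>The values 0 and \<open>\<top>\<close> of \<open>a\<close> are harmless:
    \<open>enn2real\<close> sends both to 0, \<open>ln 0 = 0\<close>, and the product is 0.\<close>
  have le: "a * ennreal (- ln (enn2real a)) \<le> 1" for a :: ennreal
  proof (cases a)
    case (real r)
    show ?thesis
    proof (cases "r = 0")
      case False
      with real have r: "r > 0" by simp
      have "- ln r \<le> 1 / r - 1"
        using ln_le_minus_one[of "1 / r"] r by (simp add: ln_div)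
      then have "r * (- ln r) \<le> 1"
        using r by (simp add: field_simps)
      moreover have "a * ennreal (- ln (enn2real a)) = ennreal (r * (- ln r))"
        unfolding real(2) enn2real_ennreal[OF real(1)] by (rule ennreal_mult'[OF real(1), symmetric])
      ultimately show ?thesis
        by simp
    qed (use real in simp)
  qed simp
  have "(\<integral>\<^sup>+x. ennreal (- ln (enn2real (h x))) \<partial>density R h)
      = (\<integral>\<^sup>+x. h x * ennreal (- ln (enn2real (h x))) \<partial>R)"
    by (simp add: nn_integral_density)
  also have "\<dots> \<le> (\<integral>\<^sup>+x. 1 \<partial>R)"
    by (intro nn_integral_mono le)
  also have "\<dots> = 1"
    using prob_space.emeasure_space_1[OF assms(1)] by simp
  finally show ?thesis .
qed

section \<open>Entropy of a measure given by a density\<close>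

lemma rel_entropy_density:
  assumes R: "prob_space R" and h[measurable]: "h \<in> borel_measurable R"
  shows "rel_entropy (density R h) R = ext_expectation (density R h) (\<lambda>x. ln (enn2real (h x)))"
proof -
  interpret prob_space R by fact
  have "AE x in R. h x = RN_deriv R (density R h) x"
    by (rule RN_deriv_unique) simp_all
  then have "AE x in density R h. h x = RN_deriv R (density R h) x"
    by (subst AE_density) auto
  then show ?thesis
    unfolding rel_entropy_def ext_expectation_def
    by (auto simp: absolutely_continuousI_density intro!: arg_cong2[of _ _ _ _ "(-)"]
        arg_cong[of _ _ enn2ereal] nn_integral_cong_AE)
qed

lemma ext_expectation_integrable:
  assumes "integrable P f"
  shows "ext_expectation P f = ereal (\<integral>x. f x \<partial>P)"
proof -
  have fin: "(\<integral>\<^sup>+x. ennreal (f x) \<partial>P) < \<top>" "(\<integral>\<^sup>+x. ennreal (- f x) \<partial>P) < \<top>"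
    using assms by (auto simp: real_integrable_def top.not_eq_extremum)
  then obtain a b where "(\<integral>\<^sup>+x. ennreal (f x) \<partial>P) = ennreal a" "a \<ge> 0"
    "(\<integral>\<^sup>+x. ennreal (- f x) \<partial>P) = ennreal b" "b \<ge> 0"
    by (metis enn2real_nonneg ennreal_enn2real)
  then show ?thesis
    unfolding ext_expectation_def real_lebesgue_integral_def[OF assms] by simp
qed

lemma ext_expectation_not_integrable:
  assumes "f \<in> borel_measurable P" "(\<integral>\<^sup>+x. ennreal (- f x) \<partial>P) < \<top>" "\<not> integrable P f"
  shows "ext_expectation P f = \<infinity>"
proof -
  have "(\<integral>\<^sup>+x. ennreal (f x) \<partial>P) = \<top>"
    using assms unfolding real_integrable_def infinity_ennreal_def by (metis less_irrefl)
  then show ?thesis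
    unfolding ext_expectation_def by simp
qed

lemma rel_entropy_density_integrable:
  assumes "prob_space R" "h \<in> borel_measurable R"
    and "integrable (density R h) (\<lambda>x. ln (enn2real (h x)))"
  shows "rel_entropy (density R h) R = ereal (\<integral>x. ln (enn2real (h x)) \<partial>density R h)"
  using rel_entropy_density[OF assms(1,2)] ext_expectation_integrable[OF assms(3)] by simp

text \<open>The negative part has finite integral, so integrability can fail only through the
  positive part. The entropy of a probability density is thus either a Bochner integral of the
  log-density or \<infinity>.\<close>

lemma rel_entropy_density_not_integrable:
  assumes "prob_space R" and [measurable]: "h \<in> borel_measurable R"
    and "\<not> integrable (density R h) (\<lambda>x. ln (enn2real (h x)))"
  shows "rel_entropy (density R h) R = \<infinity>"
proof -
  have "(\<integral>\<^sup>+x. ennreal (- ln (enn2real (h x))) \<partial>density R h) < \<top>"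
    using nn_integral_neg_ln_density_le[OF assms(1,2)] by (simp add: le_less_trans)
  with assms show ?thesis
    by (simp add: rel_entropy_density ext_expectation_not_integrable)
qed

lemma AE_density_pos:
  assumes [measurable]: "h \<in> borel_measurable R"
  shows "AE x in density R h. 0 < h x"
  by (subst AE_density) auto

lemma AE_density_finite:
  assumes [measurable]: "h \<in> borel_measurable R" and "(\<integral>\<^sup>+x. h x \<partial>R) < \<top>"
  shows "AE x in density R h. h x < \<top>"
proof -
  have "AE x in R. h x \<noteq> \<infinity>"
    using assms by (intro nn_integral_PInf_AE) auto
  then show ?thesis
    by (subst AE_density) (auto simp: top.not_eq_extremum)
qed

lemma prob_space_density_iff:
  assumes [measurable]: "h \<in> borel_measurable R"
  shows "prob_space (density R h) \<longleftrightarrow> (\<integral>\<^sup>+x. h x \<partial>R) = 1"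
proof -
  have "emeasure (density R h) (space R) = (\<integral>\<^sup>+x. h x \<partial>R)"
    by (simp add: emeasure_density cong: nn_integral_cong)
  then show ?thesis
    by (metis prob_spaceI prob_space.emeasure_space_1 space_density)
qed

text \<open>Passing to complements reverses the inequality while the total masses agree, so
  domination forces equality.\<close>

lemma eq_if_emeasure_le_prob_space:
  assumes "prob_space P" "prob_space Q" "sets P = sets Q"
    and le: "\<And>A. A \<in> sets P \<Longrightarrow> emeasure P A \<le> emeasure Q A"
  shows "P = Q"
proof (rule measure_eqI)
  interpret P: prob_space P by fact
  interpret Q: prob_space Q by fact
  have sp: "space P = space Q" using assms(3) by (rule sets_eq_imp_space_eq)
  fix A assume A: "A \<in> sets P"
  then have A': "A \<in> sets Q" using assms(3) by simp
  have "measure P A \<le> measure Q A" "measure P (space P - A) \<le> measure Q (space P - A)"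
    using le[OF A] le[of "space P - A"] A
    by (auto simp: P.emeasure_eq_measure Q.emeasure_eq_measure)
  then show "emeasure P A = emeasure Q A"
    using P.prob_compl[OF A] Q.prob_compl[OF A'] sp
    by (simp add: P.emeasure_eq_measure Q.emeasure_eq_measure)
qed fact

text \<open>Integrate \<open>ln w \<le> w - 1\<close> for the ratio \<open>w = h / g\<close> under
  \<open>density R g\<close>; equality forces \<open>w = 1\<close> almost everywhere. Both integrals
  are assumed finite so that they may be subtracted. By \<open>pos\<close> no point with
  \<open>h x = 0\<close> counts: the logarithm there should be -\<infinity>, but the convention
  gives 0.\<close>

lemma gibbs_inequality:
  assumes R: "prob_space R" and g[measurable]: "g \<in> borel_measurable R"
    and h[measurable]: "h \<in> borel_measurable R"
    and Q: "prob_space (density R g)" and Ph: "prob_space (density R h)"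
    and pos: "AE x in density R g. 0 < h x"
    and int_g: "integrable (density R g) (\<lambda>x. ln (enn2real (g x)))"
    and int_h: "integrable (density R g) (\<lambda>x. ln (enn2real (h x)))"
  shows "(\<integral>x. ln (enn2real (h x)) \<partial>density R g) \<le> (\<integral>x. ln (enn2real (g x)) \<partial>density R g)"
    and "(\<integral>x. ln (enn2real (h x)) \<partial>density R g) = (\<integral>x. ln (enn2real (g x)) \<partial>density R g) \<Longrightarrow>
      density R g = density R h"
proof -
  let ?Q = "density R g"
  interpret R: prob_space R by fact
  interpret Q: prob_space ?Q by fact
  define w where "w = (\<lambda>x. h x / g x)"
  have w[measurable]: "w \<in> borel_measurable R" unfolding w_def by measurable
  have g1: "(\<integral>\<^sup>+x. g x \<partial>R) = 1" and h1: "(\<integral>\<^sup>+x. h x \<partial>R) = 1"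
    using Q Ph by (auto simp: prob_space_density_iff)
  have h_fin: "AE x in ?Q. h x < \<top>"
  proof -
    have "AE x in R. h x \<noteq> \<infinity>"
      using h1 by (intro nn_integral_PInf_AE) auto
    then show ?thesis by (subst AE_density) (auto simp: top.not_eq_extremum)
  qed
  have g_fin: "AE x in ?Q. g x < \<top>"
    using g1 by (intro AE_density_finite) auto
  note ae = AE_density_pos[OF g] g_fin pos h_fin
  have w_pos: "AE x in ?Q. 0 < enn2real (w x) \<and> w x = ennreal (enn2real (w x)) \<and>
      ln (enn2real (w x)) = ln (enn2real (h x)) - ln (enn2real (g x))"
    using ae
  proof eventually_elim
    case (elim x)
    then obtain a b where "h x = ennreal a" "a > 0" "g x = ennreal b" "b > 0"
      by (metis ennreal_pos_finiteE)
    then show ?case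
      by (simp add: w_def divide_ennreal ln_div)
  qed
  \<comment> \<open>Only an inequality: \<open>h\<close> may carry mass where \<open>g\<close>
    vanishes, and \<open>?Q\<close> does not see that part.\<close>
  have w_le: "(\<integral>\<^sup>+x. w x \<partial>?Q) \<le> 1"
  proof -
    have "(\<integral>\<^sup>+x. w x \<partial>?Q) = (\<integral>\<^sup>+x. g x * w x \<partial>R)" by (simp add: nn_integral_density)
    also have "\<dots> \<le> (\<integral>\<^sup>+x. h x \<partial>R)"
      unfolding w_def by (intro nn_integral_mono ennreal_mult_divide_le)
    finally show ?thesis using h1 by simp
  qed
  have w_int: "integrable ?Q (\<lambda>x. enn2real (w x))"
  proof (rule integrableI_nonneg)
    have "(\<integral>\<^sup>+x. ennreal (enn2real (w x)) \<partial>?Q) \<le> (\<integral>\<^sup>+x. w x \<partial>?Q)"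
      by (intro nn_integral_mono) (auto simp: ennreal_enn2real_if)
    with w_le show "(\<integral>\<^sup>+x. ennreal (enn2real (w x)) \<partial>?Q) < \<infinity>"
      by (metis ennreal_one_less_top infinity_ennreal_def le_less_trans)
  qed auto
  have w_int_le: "(\<integral>x. enn2real (w x) \<partial>?Q) \<le> 1"
  proof -
    have "ennreal (\<integral>x. enn2real (w x) \<partial>?Q) = (\<integral>\<^sup>+x. enn2real (w x) \<partial>?Q)"
      by (rule nn_integral_eq_integral[symmetric, OF w_int]) simp
    also have "\<dots> \<le> (\<integral>\<^sup>+x. w x \<partial>?Q)"
      by (intro nn_integral_mono) (auto simp: ennreal_enn2real_if)
    finally show ?thesis using w_le order_trans ennreal_le_1 by blast
  qed
  \<comment> \<open>The slack in \<open>ln w \<le> w - 1\<close>. Its integral is at most the right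
    side minus the left side of the claim, so equality in the claim leaves no slack.\<close>
  define d where "d = (\<lambda>x. enn2real (w x) - 1 - (ln (enn2real (h x)) - ln (enn2real (g x))))"
  have d_int: "integrable ?Q d"
    unfolding d_def using w_int int_g int_h by auto
  have d_nonneg: "AE x in ?Q. 0 \<le> d x"
    using w_pos by eventually_elim (use ln_le_minus_one in \<open>force simp: d_def\<close>)
  have d_eq: "(\<integral>x. d x \<partial>?Q) = (\<integral>x. enn2real (w x) \<partial>?Q) - 1
      - ((\<integral>x. ln (enn2real (h x)) \<partial>?Q) - (\<integral>x. ln (enn2real (g x)) \<partial>?Q))"
    unfolding d_def using w_int int_g int_h Q.prob_space by simp
  have d0: "0 \<le> (\<integral>x. d x \<partial>?Q)"
    using d_nonneg by (rule integral_nonneg_AE)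
  show "(\<integral>x. ln (enn2real (h x)) \<partial>?Q) \<le> (\<integral>x. ln (enn2real (g x)) \<partial>?Q)"
    using d0 d_eq w_int_le by simp
  assume eq: "(\<integral>x. ln (enn2real (h x)) \<partial>?Q) = (\<integral>x. ln (enn2real (g x)) \<partial>?Q)"
  have "(\<integral>x. d x \<partial>?Q) = 0"
    using d0 d_eq w_int_le eq by simp
  then have "AE x in ?Q. d x = 0"
    using integral_nonneg_eq_0_iff_AE[OF d_int d_nonneg] by simp
  then have "AE x in ?Q. h x = g x"
    using w_pos ae
  proof eventually_elim
    case (elim x)
    then have "ln (enn2real (w x)) = enn2real (w x) - 1" by (simp add: d_def)
    with elim have "w x = 1" using ln_eq_minus_one by (metis ennreal_1)
    then show ?case using elim unfolding w_def
      by (metis ennreal_divide_times less_irrefl mult_1 mult_divide_eq_ennreal)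
  qed
  \<comment> \<open>Nothing is known about \<open>h\<close> where \<open>g\<close> vanishes. There
    \<open>g\<close> contributes nothing, so one measure still dominates the other, and equal total
    mass does the rest.\<close>
  then have hg: "AE x in R. 0 < g x \<longrightarrow> h x = g x"
    by (simp add: AE_density)
  show "density R g = density R h"
  proof (rule eq_if_emeasure_le_prob_space[OF Q Ph])
    fix A assume "A \<in> sets (density R g)"
    then have [measurable]: "A \<in> sets R" by simp
    show "emeasure (density R g) A \<le> emeasure (density R h) A"
      by (simp add: emeasure_density, rule nn_integral_mono_AE, use hg in eventually_elim)
         (auto simp: zero_less_iff_neq_zero split: split_indicator)
  qed simp
qed

lemma distr_density_comp:
  assumes f[measurable]: "f \<in> R \<rightarrow>\<^sub>M E" and h[measurable]: "h \<in> borel_measurable E"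
  shows "distr (density R (\<lambda>x. h (f x))) E f = density (distr R E f) h"
proof (rule measure_eqI)
  fix A assume "A \<in> sets (distr (density R (\<lambda>x. h (f x))) E f)"
  then have [measurable]: "A \<in> sets E" by simp
  show "emeasure (distr (density R (\<lambda>x. h (f x))) E f) A = emeasure (density (distr R E f) h) A"
    by (simp add: emeasure_distr emeasure_density nn_integral_distr)
       (intro nn_integral_cong, auto split: split_indicator)
qed simp

text \<open>The reference density factors through \<open>f\<close>, so the integral of its logarithm
  is the same number \<open>?c\<close> for every law with image \<open>\<nu>\<close>, and Gibbs'
  inequality compares each competitor with \<open>?c\<close>. The hypothesis \<open>int\<close>
  makes the least value finite, hence the minimiser unique. The whole, the past and the future
  problem are all instances.\<close>

lemma minimises_entropy_iff_density:
  assumes R: "R \<in> space (prob_algebra S)"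
    and f[measurable]: "f \<in> S \<rightarrow>\<^sub>M E" and h[measurable]: "h \<in> borel_measurable E"
    and \<nu>: "\<nu> = density (distr R E f) h" "prob_space \<nu>"
    and int: "integrable \<nu> (\<lambda>z. ln (enn2real (h z)))"
  shows "minimises_entropy (laws_with_image S E f \<nu>) R P \<longleftrightarrow> P = density R (\<lambda>x. h (f x))"
proof -
  have sR: "sets R = sets S" and pR: "prob_space R"
    using R by (auto simp: space_prob_algebra)
  have fR[measurable]: "f \<in> R \<rightarrow>\<^sub>M E" using f sR by (simp cong: measurable_cong_sets)
  define Ps where "Ps = density R (\<lambda>x. h (f x))"
  let ?C = "laws_with_image S E f \<nu>"
  let ?c = "\<integral>z. ln (enn2real (h z)) \<partial>\<nu>"
  have Ps_distr: "distr Ps E f = \<nu>"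
    unfolding Ps_def \<nu>(1) by (rule distr_density_comp) measurable
  have Ps_prob: "prob_space Ps"
  proof -
    have "(\<integral>\<^sup>+x. h (f x) \<partial>R) = 1"
      using \<nu> by (simp add: prob_space_density_iff nn_integral_distr)
    then show ?thesis unfolding Ps_def by (simp add: prob_space_density_iff)
  qed
  have Ps_C: "Ps \<in> ?C"
    using Ps_distr Ps_prob by (auto simp: laws_with_image_def space_prob_algebra Ps_def sR)
  have C_int: "integrable Q (\<lambda>x. ln (enn2real (h (f x))))"
    and C_integral: "(\<integral>x. ln (enn2real (h (f x))) \<partial>Q) = ?c"
    and C_pos: "AE x in Q. 0 < h (f x)"
    if "Q \<in> ?C" for Q
  proof -
    have sQ: "sets Q = sets S" and dQ: "distr Q E f = \<nu>"
      using that by (auto simp: laws_with_image_def space_prob_algebra)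
    have [measurable]: "f \<in> Q \<rightarrow>\<^sub>M E"
      using f sQ by (simp cong: measurable_cong_sets)
    show "integrable Q (\<lambda>x. ln (enn2real (h (f x))))"
      using int unfolding dQ[symmetric] by (subst (asm) integrable_distr_eq) auto
    show "(\<integral>x. ln (enn2real (h (f x))) \<partial>Q) = ?c"
      unfolding dQ[symmetric] by (subst integral_distr) auto
    have "AE z in \<nu>. 0 < h z"
      unfolding \<nu>(1) by (rule AE_density_pos) simp
    then show "AE x in Q. 0 < h (f x)"
      unfolding dQ[symmetric] by (subst (asm) AE_distr_iff) auto
  qed
  have Ps_ent: "rel_entropy Ps R = ereal ?c"
    using C_int[OF Ps_C] C_integral[OF Ps_C] unfolding Ps_def
    by (subst rel_entropy_density_integrable[OF pR]) auto
  \<comment> \<open>Gibbs' inequality concerns competitors with an integrable log-density; all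
    others, including those that are not absolutely continuous, have entropy \<infinity> and cannot
    attain \<open>?c\<close>.\<close>
  have key: "ereal ?c \<le> rel_entropy Q R \<and> (rel_entropy Q R = ereal ?c \<longrightarrow> Q = Ps)"
    if Q: "Q \<in> ?C" for Q
  proof (cases "absolutely_continuous R Q")
    case True
    interpret R: prob_space R by fact
    have sQ: "sets Q = sets R" and pQ: "prob_space Q"
      using Q sR by (auto simp: laws_with_image_def space_prob_algebra)
    define g where "g = RN_deriv R Q"
    have g[measurable]: "g \<in> borel_measurable R" unfolding g_def by simp
    have Qg: "Q = density R g"
      unfolding g_def using R.density_RN_deriv[OF True sQ] by simp
    show ?thesis
    proof (cases "integrable Q (\<lambda>x. ln (enn2real (g x)))")
      case int_g: True
      have ent: "rel_entropy Q R = ereal (\<integral>x. ln (enn2real (g x)) \<partial>Q)"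
        using rel_entropy_density_integrable[OF pR g] int_g Qg by simp
      have hf: "(\<lambda>x. h (f x)) \<in> borel_measurable R" by measurable
      note * = gibbs_inequality[OF pR g hf _ _ _ _ _, folded Qg Ps_def,
          OF pQ Ps_prob C_pos[OF Q] int_g C_int[OF Q]]
      show ?thesis
        using * unfolding ent C_integral[OF Q] by auto
    next
      case False
      then have "rel_entropy Q R = \<infinity>"
        using rel_entropy_density_not_integrable[OF pR g] Qg by simp
      then show ?thesis by simp
    qed
  qed (simp add: rel_entropy_def)
  show ?thesis
    unfolding minimises_entropy_def Ps_def[symmetric]
    using key Ps_C Ps_ent by (metis order_antisym)
qed

section \<open>Disintegrations on countably generated spaces\<close>

text \<open>Turns the \<open>bind\<close> of the definition into an iterated integral, the form in
  which disintegrations are exploited below.\<close>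

lemma disintegrates_nn_integral:
  assumes K: "disintegrates L M\<^sub>1 X M\<^sub>2 Y K"
    and [measurable]: "X \<in> L \<rightarrow>\<^sub>M M\<^sub>1" "Y \<in> L \<rightarrow>\<^sub>M M\<^sub>2" "F \<in> borel_measurable (M\<^sub>1 \<Otimes>\<^sub>M M\<^sub>2)"
  shows "(\<integral>\<^sup>+\<omega>. F (X \<omega>, Y \<omega>) \<partial>L) = (\<integral>\<^sup>+x. \<integral>\<^sup>+y. F (x, y) \<partial>K x \<partial>distr L M\<^sub>1 X)"
proof -
  have K_meas[measurable]: "K \<in> M\<^sub>1 \<rightarrow>\<^sub>M prob_algebra M\<^sub>2"
    and joint: "distr L (M\<^sub>1 \<Otimes>\<^sub>M M\<^sub>2) (\<lambda>\<omega>. (X \<omega>, Y \<omega>)) =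
       bind (distr L M\<^sub>1 X) (\<lambda>x. distr (K x) (M\<^sub>1 \<Otimes>\<^sub>M M\<^sub>2) (Pair x))"
    using K by (auto simp: disintegrates_def)
  have "(\<lambda>x. distr (K x) (M\<^sub>1 \<Otimes>\<^sub>M M\<^sub>2) (Pair x)) \<in> M\<^sub>1 \<rightarrow>\<^sub>M prob_algebra (M\<^sub>1 \<Otimes>\<^sub>M M\<^sub>2)"
    by measurable
  from measurable_prob_algebraD[OF this]
  have kernel: "(\<lambda>x. distr (K x) (M\<^sub>1 \<Otimes>\<^sub>M M\<^sub>2) (Pair x)) \<in> distr L M\<^sub>1 X \<rightarrow>\<^sub>M subprob_algebra (M\<^sub>1 \<Otimes>\<^sub>M M\<^sub>2)"
    by simp
  have "(\<integral>\<^sup>+\<omega>. F (X \<omega>, Y \<omega>) \<partial>L) = (\<integral>\<^sup>+z. F z \<partial>distr L (M\<^sub>1 \<Otimes>\<^sub>M M\<^sub>2) (\<lambda>\<omega>. (X \<omega>, Y \<omega>)))"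
    by (simp add: nn_integral_distr)
  also have "\<dots> = (\<integral>\<^sup>+x. \<integral>\<^sup>+z. F z \<partial>distr (K x) (M\<^sub>1 \<Otimes>\<^sub>M M\<^sub>2) (Pair x) \<partial>distr L M\<^sub>1 X)"
    unfolding joint by (rule nn_integral_bind[OF _ kernel]) measurable
  also have "\<dots> = (\<integral>\<^sup>+x. \<integral>\<^sup>+y. F (x, y) \<partial>K x \<partial>distr L M\<^sub>1 X)"
  proof (rule nn_integral_cong)
    fix x assume "x \<in> space (distr L M\<^sub>1 X)"
    then have x[measurable]: "x \<in> space M\<^sub>1" by simp
    then have [measurable_cong]: "sets (K x) = sets M\<^sub>2"
      using measurable_space[OF K_meas] by (auto simp: space_prob_algebra)
    show "(\<integral>\<^sup>+z. F z \<partial>distr (K x) (M\<^sub>1 \<Otimes>\<^sub>M M\<^sub>2) (Pair x)) = (\<integral>\<^sup>+y. F (x, y) \<partial>K x)"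
      by (rule nn_integral_distr) measurable
  qed
  finally show ?thesis .
qed

text \<open>A condition on the sigma-algebra alone, without a topology, since future paths form a
  trace of an uncountable product. Its purpose is to collect the exceptional null sets of countably
  many events into one.\<close>

definition countably_generated :: "'a measure \<Rightarrow> bool" where
  "countably_generated M \<longleftrightarrow> (\<exists>G. countable G \<and> G \<subseteq> Pow (space M) \<and> sets M = sigma_sets (space M) G)"

lemma countably_generatedE:
  assumes "countably_generated M"
  obtains G where "countable G" "Int_stable G" "space M \<in> G" "G \<subseteq> Pow (space M)"
    "sets M = sigma_sets (space M) G"
proof -
  obtain G where G: "countable G" "G \<subseteq> Pow (space M)" "sets M = sigma_sets (space M) G"
    using assms by (auto simp: countably_generated_def)
  \<comment> \<open>Finite intersections keep the generator countable and make it
    intersection-stable. Because of the factor \<open>space M\<close> the empty family yields the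
    whole space instead of \<open>UNIV\<close>.\<close>
  define G' where "G' = (\<lambda>F. space M \<inter> \<Inter>F) ` {F. finite F \<and> F \<subseteq> G}"
  have "countable G'"
    unfolding G'_def using countable_Collect_finite_subset[OF G(1)] by auto
  moreover have "Int_stable G'"
    unfolding Int_stable_def G'_def
  proof (clarsimp)
    fix F F' assume F: "finite F" "F \<subseteq> G" "finite F'" "F' \<subseteq> G"
    have "space M \<inter> \<Inter>F \<inter> (space M \<inter> \<Inter>F') = space M \<inter> \<Inter>(F \<union> F')" by auto
    with F show "space M \<inter> \<Inter>F \<inter> (space M \<inter> \<Inter>F') \<in> (\<lambda>F. space M \<inter> \<Inter>F) ` {F. finite F \<and> F \<subseteq> G}"
      by (auto intro!: image_eqI[of _ _ "F \<union> F'"])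
  qed
  moreover have "space M \<in> G'"
    unfolding G'_def by (rule image_eqI[of _ _ "{}"]) auto
  moreover have "G' \<subseteq> Pow (space M)"
    unfolding G'_def by auto
  moreover have "sets M = sigma_sets (space M) G'"
  proof
    have "G \<subseteq> G'"
    proof
      fix A assume "A \<in> G"
      with G(2) show "A \<in> G'" unfolding G'_def by (intro image_eqI[of _ _ "{A}"]) auto
    qed
    then show "sets M \<subseteq> sigma_sets (space M) G'"
      unfolding G(3) by (rule sigma_sets_mono')
    have "space M \<inter> \<Inter>F \<in> sets M" if "finite F" "F \<subseteq> G" for F
      using that
    proof (induction F)
      case (insert A F)
      then have "A \<in> sets M" using G(3) by auto
      moreover have "space M \<inter> \<Inter>(insert A F) = A \<inter> (space M \<inter> \<Inter>F)" by auto
      ultimately show ?case using insert by auto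
    qed simp
    then show "sigma_sets (space M) G' \<subseteq> sets M"
      unfolding G'_def by (intro sets.sigma_sets_subset) auto
  qed
  ultimately show ?thesis by (rule that)
qed

text \<open>The exceptional set in \<open>eq\<close> depends on \<open>B\<close>. The countably many
  events of an intersection-stable generator share one null set, and off it the two measures agree
  because they agree on the generator.\<close>

lemma AE_measure_eq_countably_generated:
  assumes M\<^sub>2: "countably_generated M\<^sub>2"
    and K: "AE x in L. prob_space (K x) \<and> sets (K x) = sets M\<^sub>2" "AE x in L. sets (K' x) = sets M\<^sub>2"
    and eq: "\<And>B. B \<in> sets M\<^sub>2 \<Longrightarrow> AE x in L. emeasure (K x) B = emeasure (K' x) B"
  shows "AE x in L. K x = K' x"
proof -
  obtain G where G: "countable G" "Int_stable G" "space M\<^sub>2 \<in> G" "G \<subseteq> Pow (space M\<^sub>2)"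
    "sets M\<^sub>2 = sigma_sets (space M\<^sub>2) G"
    using countably_generatedE[OF M\<^sub>2] .
  have "AE x in L. \<forall>B\<in>G. emeasure (K x) B = emeasure (K' x) B"
    using G(1,5) by (subst AE_ball_countable) (auto intro!: eq)
  with K show ?thesis
  proof eventually_elim
    case (elim x)
    interpret prob_space "K x" using elim by simp
    show "K x = K' x"
      by (rule measure_eqI_generator_eq[where E=G and \<Omega>="space M\<^sub>2" and A="\<lambda>_. space M\<^sub>2"])
        (use elim G in auto)
  qed
qed

section \<open>Integrals and densities along kernels\<close>

lemma kernel_integral_measurable:
  assumes "\<kappa> \<in> M\<^sub>1 \<rightarrow>\<^sub>M prob_algebra M\<^sub>2" "F \<in> borel_measurable (M\<^sub>1 \<Otimes>\<^sub>M M\<^sub>2)"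
  shows "(\<lambda>x. \<integral>\<^sup>+y. F (x, y) \<partial>\<kappa> x) \<in> borel_measurable M\<^sub>1"
  by (rule nn_integral_measurable_subprob_algebra2[where N=M\<^sub>2])
     (use assms in \<open>auto dest: measurable_prob_algebraD simp: case_prod_beta'\<close>)

text \<open>For \<open>b = 0\<close> the bound forces \<open>a = 0\<close>, so cancellation survives
  division by zero; only an infinite divisor is excluded.\<close>

lemma ennreal_mult_divide_cancel_le:
  fixes a b :: ennreal
  assumes "a \<le> b" "b < \<top>"
  shows "b * (a / b) = a"
proof (cases "b = 0")
  case False
  then show ?thesis using assms(2) by (intro ennreal_mult_divide_cancel) auto
qed (use assms(1) in simp)

lemma kernel_space:
  assumes "\<kappa> \<in> M\<^sub>1 \<rightarrow>\<^sub>M prob_algebra M\<^sub>2" "x \<in> space M\<^sub>1"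
  shows "sets (\<kappa> x) = sets M\<^sub>2" "prob_space (\<kappa> x)"
  using measurable_space[OF assms] by (auto simp: space_prob_algebra)

lemma kernel_section_measurable:
  assumes "\<kappa> \<in> M\<^sub>1 \<rightarrow>\<^sub>M prob_algebra M\<^sub>2" "x \<in> space M\<^sub>1" "F \<in> borel_measurable (M\<^sub>1 \<Otimes>\<^sub>M M\<^sub>2)"
  shows "(\<lambda>y. F (x, y)) \<in> borel_measurable (\<kappa> x)"
  using kernel_space[OF assms(1,2)] assms(2,3) by (simp cong: measurable_cong_sets)

text \<open>The section \<open>F (x, _)\<close> is normalised by its mass \<open>F\<^sub>1 x\<close>; where this mass is \<open>0\<close> or
  \<open>\<infinity>\<close> the quotient is junk, but \<open>density L F\<^sub>1\<close> does not charge such points.\<close>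

lemma AE_kernel_eq_density:
  fixes F :: "'a \<times> 'b \<Rightarrow> ennreal"
  assumes \<kappa>: "\<kappa> \<in> M\<^sub>1 \<rightarrow>\<^sub>M prob_algebra M\<^sub>2" and K: "K \<in> M\<^sub>1 \<rightarrow>\<^sub>M prob_algebra M\<^sub>2"
    and L: "sets L = sets M\<^sub>1"
    and F[measurable]: "F \<in> borel_measurable (M\<^sub>1 \<Otimes>\<^sub>M M\<^sub>2)"
    and F\<^sub>1: "\<And>x. x \<in> space M\<^sub>1 \<Longrightarrow> F\<^sub>1 x = (\<integral>\<^sup>+y. F (x, y) \<partial>\<kappa> x)"
    and fin: "(\<integral>\<^sup>+x. F\<^sub>1 x \<partial>L) < \<top>"
    and M\<^sub>2: "countably_generated M\<^sub>2"
    and eq: "\<And>A B. A \<in> sets M\<^sub>1 \<Longrightarrow> B \<in> sets M\<^sub>2 \<Longrightarrow>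
      (\<integral>\<^sup>+x. emeasure (K x) B * indicator A x \<partial>density L F\<^sub>1) =
      (\<integral>\<^sup>+x. (\<integral>\<^sup>+y. F (x, y) * indicator B y \<partial>\<kappa> x) * indicator A x \<partial>L)"
  shows "AE x in density L F\<^sub>1. K x = density (\<kappa> x) (\<lambda>y. F (x, y) / F\<^sub>1 x)"
proof -
  have [measurable_cong]: "sets L = sets M\<^sub>1" by fact
  have spL: "space L = space M\<^sub>1" using L by (rule sets_eq_imp_space_eq)
  have F\<^sub>1_meas[measurable]: "F\<^sub>1 \<in> borel_measurable M\<^sub>1"
    using kernel_integral_measurable[OF \<kappa> F] F\<^sub>1 by (simp cong: measurable_cong)
  define D where "D = density L F\<^sub>1"
  have [measurable_cong]: "sets D = sets M\<^sub>1" by (simp add: D_def L)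
  have spD: "space D = space M\<^sub>1" by (simp add: D_def spL)
  interpret D: finite_measure D
  proof
    have "emeasure D (space D) = (\<integral>\<^sup>+x. F\<^sub>1 x \<partial>L)"
      unfolding D_def by (simp add: emeasure_density cong: nn_integral_cong)
    with fin show "emeasure D (space D) \<noteq> \<infinity>" by auto
  qed
  have F\<^sub>1_fin: "AE x in L. F\<^sub>1 x \<noteq> \<infinity>"
    by (rule nn_integral_PInf_AE) (use fin in auto)
  have section_eq: "AE x in D. emeasure (K x) B =
      emeasure (density (\<kappa> x) (\<lambda>y. F (x, y) / F\<^sub>1 x)) B" if B: "B \<in> sets M\<^sub>2" for B
  proof -
    note [measurable] = B
    define I where "I = (\<lambda>x. \<integral>\<^sup>+y. F (x, y) * indicator B y \<partial>\<kappa> x)"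
    have I_meas[measurable]: "I \<in> borel_measurable M\<^sub>1"
    proof -
      have "(\<lambda>z. F z * indicator B (snd z)) \<in> borel_measurable (M\<^sub>1 \<Otimes>\<^sub>M M\<^sub>2)" by measurable
      from kernel_integral_measurable[OF \<kappa> this] show ?thesis by (simp add: I_def)
    qed
    have K_meas[measurable]: "(\<lambda>x. emeasure (K x) B) \<in> borel_measurable M\<^sub>1"
      using measurable_emeasure_kernel[OF measurable_prob_algebraD[OF K] B] .
    have I_le: "I x \<le> F\<^sub>1 x" if "x \<in> space M\<^sub>1" for x
      unfolding I_def F\<^sub>1[OF that] by (intro nn_integral_mono) (auto split: split_indicator)
    have em: "emeasure (density (\<kappa> x) (\<lambda>y. F (x, y) / F\<^sub>1 x)) B = I x / F\<^sub>1 x"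
      if x: "x \<in> space M\<^sub>1" for x
    proof -
      have [measurable]: "(\<lambda>y. F (x, y)) \<in> borel_measurable (\<kappa> x)" "B \<in> sets (\<kappa> x)"
        using kernel_section_measurable[OF \<kappa> x F] kernel_space[OF \<kappa> x] B by auto
      have "emeasure (density (\<kappa> x) (\<lambda>y. F (x, y) / F\<^sub>1 x)) B =
          (\<integral>\<^sup>+y. F (x, y) * indicator B y / F\<^sub>1 x \<partial>\<kappa> x)"
        by (subst emeasure_density) (auto intro!: nn_integral_cong split: split_indicator)
      also have "\<dots> = I x / F\<^sub>1 x"
        unfolding I_def by (rule nn_integral_divide) measurable
      finally show ?thesis .
    qed
    \<comment> \<open>For fixed \<open>B\<close> both sides act as densities with respect to the
      finite measure \<open>D\<close> and have equal integrals over every \<open>A\<close>. The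
      weight \<open>F\<^sub>1\<close> of \<open>D\<close> cancels the denominator, also where it is
      0, since \<open>I x \<le> F\<^sub>1 x\<close>.\<close>
    have "AE x in D. emeasure (K x) B = I x / F\<^sub>1 x"
    proof (rule D.density_unique_finite_measure)
      fix A assume "A \<in> sets D"
      then have A[measurable]: "A \<in> sets M\<^sub>1" by (simp add: D_def L)
      have "(\<integral>\<^sup>+x. I x / F\<^sub>1 x * indicator A x \<partial>D) = (\<integral>\<^sup>+x. F\<^sub>1 x * (I x / F\<^sub>1 x * indicator A x) \<partial>L)"
        unfolding D_def by (subst nn_integral_density) measurable
      also have "\<dots> = (\<integral>\<^sup>+x. I x * indicator A x \<partial>L)"
        using F\<^sub>1_fin
      proof (intro nn_integral_cong_AE, elim AE_mp, intro AE_I2 impI)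
        fix x assume "x \<in> space L" "F\<^sub>1 x \<noteq> \<infinity>"
        then have "F\<^sub>1 x * (I x / F\<^sub>1 x) = I x"
          using I_le spL by (intro ennreal_mult_divide_cancel_le) (auto simp: top.not_eq_extremum)
        then show "F\<^sub>1 x * (I x / F\<^sub>1 x * indicator A x) = I x * indicator A x"
          by (metis mult.assoc)
      qed
      also have "\<dots> = (\<integral>\<^sup>+x. emeasure (K x) B * indicator A x \<partial>D)"
        unfolding D_def I_def using eq[OF A B] by simp
      finally show "(\<integral>\<^sup>+x. emeasure (K x) B * indicator A x \<partial>D) = (\<integral>\<^sup>+x. I x / F\<^sub>1 x * indicator A x \<partial>D)"
        by simp
    qed auto
    then show ?thesis
      by (elim AE_mp, intro AE_I2) (simp add: em spD)
  qed
  show ?thesis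
    unfolding D_def[symmetric]
    by (rule AE_measure_eq_countably_generated[OF M\<^sub>2])
       (auto intro!: AE_I2 section_eq simp: kernel_space[OF K] kernel_space[OF \<kappa>] spD)
qed

text \<open>Every event of \<open>S\<close> is a preimage under \<open>Z\<close>, so the
  push-forward along \<open>Z\<close> loses nothing. It serves for the splitting of paths and of
  grid vectors into past and future.\<close>

lemma measure_eqI_distr:
  assumes "sets P = sets S" "sets Q = sets S"
    and Z: "Z \<in> S \<rightarrow>\<^sub>M N" and gen: "\<And>A. A \<in> sets S \<Longrightarrow> \<exists>B\<in>sets N. A = Z -` B \<inter> space S"
    and eq: "distr P N Z = distr Q N Z"
  shows "P = Q"
proof (rule measure_eqI)
  have sp: "space P = space S" "space Q = space S"
    using assms(1,2) by (auto dest: sets_eq_imp_space_eq)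
  have [measurable]: "Z \<in> P \<rightarrow>\<^sub>M N" "Z \<in> Q \<rightarrow>\<^sub>M N"
    using Z assms(1,2) by (simp_all cong: measurable_cong_sets)
  fix A assume "A \<in> sets P"
  then obtain B where [measurable]: "B \<in> sets N" and B: "A = Z -` B \<inter> space S"
    using gen assms(1) by auto
  have "emeasure (distr P N Z) B = emeasure (distr Q N Z) B" using eq by simp
  then show "emeasure P A = emeasure Q A"
    by (simp add: emeasure_distr sp B)
qed (use assms in simp)

section \<open>Disintegration of a density\<close>

lemma emeasure_distr_eq_nn_integral:
  assumes "Z \<in> Q \<rightarrow>\<^sub>M N" "A \<in> sets N"
  shows "emeasure (distr Q N Z) A = (\<integral>\<^sup>+\<omega>. indicator A (Z \<omega>) \<partial>Q)"
  using nn_integral_distr[OF assms(1), of "indicator A"] assms(2) by simp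

lemma disintegratesI_nn_integral:
  assumes L: "prob_space L" and [measurable]: "X \<in> L \<rightarrow>\<^sub>M M\<^sub>1" "Y \<in> L \<rightarrow>\<^sub>M M\<^sub>2"
    and K[measurable]: "K \<in> M\<^sub>1 \<rightarrow>\<^sub>M prob_algebra M\<^sub>2"
    and int: "\<And>F. F \<in> borel_measurable (M\<^sub>1 \<Otimes>\<^sub>M M\<^sub>2) \<Longrightarrow>
      (\<integral>\<^sup>+\<omega>. F (X \<omega>, Y \<omega>) \<partial>L) = (\<integral>\<^sup>+x. \<integral>\<^sup>+y. F (x, y) \<partial>K x \<partial>distr L M\<^sub>1 X)"
  shows "disintegrates L M\<^sub>1 X M\<^sub>2 Y K"
  unfolding disintegrates_def
proof (intro conjI K measure_eqI)
  interpret L: prob_space L by fact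
  let ?k = "\<lambda>x. distr (K x) (M\<^sub>1 \<Otimes>\<^sub>M M\<^sub>2) (Pair x)"
  have "?k \<in> M\<^sub>1 \<rightarrow>\<^sub>M prob_algebra (M\<^sub>1 \<Otimes>\<^sub>M M\<^sub>2)"
    by measurable
  from measurable_prob_algebraD[OF this]
  have k: "?k \<in> distr L M\<^sub>1 X \<rightarrow>\<^sub>M subprob_algebra (M\<^sub>1 \<Otimes>\<^sub>M M\<^sub>2)"
    by simp
  \<comment> \<open>Over a measure with empty space \<open>bind\<close> takes a default value, so
    its sigma-algebra is under control only once the marginal is known to live on a nonempty
    space.\<close>
  have ne: "space (distr L M\<^sub>1 X) \<noteq> {}"
    by (rule prob_space.not_empty, rule L.prob_space_distr) fact
  show sets: "sets (distr L (M\<^sub>1 \<Otimes>\<^sub>M M\<^sub>2) (\<lambda>\<omega>. (X \<omega>, Y \<omega>))) = sets (bind (distr L M\<^sub>1 X) ?k)"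
    using sets_bind[OF sets_kernel[OF k] ne] by simp
  fix A assume "A \<in> sets (distr L (M\<^sub>1 \<Otimes>\<^sub>M M\<^sub>2) (\<lambda>\<omega>. (X \<omega>, Y \<omega>)))"
  then have A[measurable]: "A \<in> sets (M\<^sub>1 \<Otimes>\<^sub>M M\<^sub>2)" by simp
  have "emeasure (distr L (M\<^sub>1 \<Otimes>\<^sub>M M\<^sub>2) (\<lambda>\<omega>. (X \<omega>, Y \<omega>))) A =
      (\<integral>\<^sup>+\<omega>. indicator A (X \<omega>, Y \<omega>) \<partial>L)"
    by (rule emeasure_distr_eq_nn_integral) measurable
  also have "\<dots> = (\<integral>\<^sup>+x. \<integral>\<^sup>+y. indicator A (x, y) \<partial>K x \<partial>distr L M\<^sub>1 X)"
    by (rule int) measurable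
  also have "\<dots> = (\<integral>\<^sup>+x. \<integral>\<^sup>+z. indicator A z \<partial>?k x \<partial>distr L M\<^sub>1 X)"
  proof (rule nn_integral_cong)
    fix x assume "x \<in> space (distr L M\<^sub>1 X)"
    then have x[measurable]: "x \<in> space M\<^sub>1" by simp
    have [measurable_cong]: "sets (K x) = sets M\<^sub>2" by (rule kernel_space[OF K x])
    show "(\<integral>\<^sup>+y. indicator A (x, y) \<partial>K x) = (\<integral>\<^sup>+z. indicator A z \<partial>?k x)"
      by (rule nn_integral_distr[symmetric]) measurable
  qed
  also have "\<dots> = (\<integral>\<^sup>+z. indicator A z \<partial>bind (distr L M\<^sub>1 X) ?k)"
    by (rule nn_integral_bind[symmetric, OF _ k]) measurable
  also have "\<dots> = emeasure (bind (distr L M\<^sub>1 X) ?k) A"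
    by (rule nn_integral_indicator) (simp only: sets[symmetric] sets_distr A)
  finally show "emeasure (distr L (M\<^sub>1 \<Otimes>\<^sub>M M\<^sub>2) (\<lambda>\<omega>. (X \<omega>, Y \<omega>))) A = emeasure (bind (distr L M\<^sub>1 X) ?k) A" .
qed

text \<open>For \<open>a \<ge> 1\<close> write \<open>ln a = ln b + ln (a / b)\<close>; for
  \<open>a < 1\<close> use \<open>- ln a \<le> 1 / a - 1\<close>. With \<open>a\<close> a marginal
  and \<open>b\<close> a joint density this bounds the marginal log-density without a conditional
  Jensen inequality.\<close>

lemma abs_ln_le_quotients:
  fixes a b :: real
  assumes "a > 0" "b > 0"
  shows "\<bar>ln a\<bar> \<le> \<bar>ln b\<bar> + a / b + 1 / a"
proof (cases "a \<ge> 1")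
  case True
  have "ln a = ln b + ln (a / b)" using assms by (simp add: ln_div)
  moreover have "ln (a / b) \<le> a / b - 1" using assms by (intro ln_le_minus_one) simp
  moreover have "1 / a > 0" using assms by simp
  ultimately show ?thesis using True ln_ge_zero[OF True] by linarith
next
  case False
  have "- ln a \<le> 1 / a - 1" using ln_le_minus_one[of "1 / a"] assms by (simp add: ln_div)
  moreover have "a / b > 0" "ln a < 0" using assms False by simp_all
  ultimately show ?thesis by linarith
qed

text \<open>The law \<open>L\<close> is reweighted by a function \<open>F\<close> of
  \<open>(X, Y)\<close>, and \<open>F\<^sub>1\<close> is the marginal density that results. There
  are two instances, grid vectors and paths. \<open>F\<^sub>1\<close> is a parameter with a
  pointwise specification, not a definition, so that the path instance can take the grid function
  composed with the projection.\<close>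

locale density_disintegration =
  fixes L :: "'w measure" and M\<^sub>1 :: "'x measure" and X and M\<^sub>2 :: "'y measure" and Y and \<kappa>
    and F :: "'x \<times> 'y \<Rightarrow> ennreal" and F\<^sub>1 :: "'x \<Rightarrow> ennreal"
  assumes L: "prob_space L"
    and X[measurable]: "X \<in> L \<rightarrow>\<^sub>M M\<^sub>1" and Y[measurable]: "Y \<in> L \<rightarrow>\<^sub>M M\<^sub>2"
    and \<kappa>: "disintegrates L M\<^sub>1 X M\<^sub>2 Y \<kappa>"
    and F[measurable]: "F \<in> borel_measurable (M\<^sub>1 \<Otimes>\<^sub>M M\<^sub>2)"
    and F\<^sub>1: "\<And>x. x \<in> space M\<^sub>1 \<Longrightarrow> F\<^sub>1 x = (\<integral>\<^sup>+y. F (x, y) \<partial>\<kappa> x)"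
    and N_prob: "prob_space (density L (\<lambda>\<omega>. F (X \<omega>, Y \<omega>)))"
begin

definition "L\<^sub>1 = distr L M\<^sub>1 X"

definition "N = density L (\<lambda>\<omega>. F (X \<omega>, Y \<omega>))"

lemma \<kappa>_kernel: "\<kappa> \<in> M\<^sub>1 \<rightarrow>\<^sub>M prob_algebra M\<^sub>2"
  using \<kappa> by (simp add: disintegrates_def)

lemma sets_simps[measurable_cong, simp]: "sets L\<^sub>1 = sets M\<^sub>1" "sets N = sets L"
  by (simp_all add: L\<^sub>1_def N_def)

lemma space_simps[simp]: "space L\<^sub>1 = space M\<^sub>1" "space N = space L"
  by (simp_all add: L\<^sub>1_def N_def)

lemma F\<^sub>1_measurable[measurable]: "F\<^sub>1 \<in> borel_measurable M\<^sub>1"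
  using kernel_integral_measurable[OF \<kappa>_kernel F] F\<^sub>1 by (simp cong: measurable_cong)

lemma L_integral:
  "G \<in> borel_measurable (M\<^sub>1 \<Otimes>\<^sub>M M\<^sub>2) \<Longrightarrow>
    (\<integral>\<^sup>+\<omega>. G (X \<omega>, Y \<omega>) \<partial>L) = (\<integral>\<^sup>+x. \<integral>\<^sup>+y. G (x, y) \<partial>\<kappa> x \<partial>L\<^sub>1)"
  unfolding L\<^sub>1_def by (rule disintegrates_nn_integral[OF \<kappa> X Y])

lemma N_integral:
  assumes [measurable]: "G \<in> borel_measurable (M\<^sub>1 \<Otimes>\<^sub>M M\<^sub>2)"
  shows "(\<integral>\<^sup>+\<omega>. G (X \<omega>, Y \<omega>) \<partial>N) = (\<integral>\<^sup>+x. \<integral>\<^sup>+y. F (x, y) * G (x, y) \<partial>\<kappa> x \<partial>L\<^sub>1)"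
  unfolding N_def using L_integral[of "\<lambda>z. F z * G z"] by (simp add: nn_integral_density)

lemma marginal: "distr N M\<^sub>1 X = density L\<^sub>1 F\<^sub>1"
proof (rule measure_eqI)
  fix A assume "A \<in> sets (distr N M\<^sub>1 X)"
  then have A[measurable]: "A \<in> sets M\<^sub>1" by simp
  have "emeasure (distr N M\<^sub>1 X) A = (\<integral>\<^sup>+\<omega>. indicator A (X \<omega>) \<partial>N)"
    by (rule emeasure_distr_eq_nn_integral) measurable
  also have "\<dots> = (\<integral>\<^sup>+x. \<integral>\<^sup>+y. F (x, y) * indicator A x \<partial>\<kappa> x \<partial>L\<^sub>1)"
    using N_integral[of "\<lambda>z. indicator A (fst z)"] by simp
  also have "\<dots> = (\<integral>\<^sup>+x. F\<^sub>1 x * indicator A x \<partial>L\<^sub>1)"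
    by (intro nn_integral_cong)
       (auto simp: F\<^sub>1 intro!: nn_integral_multc kernel_section_measurable[OF \<kappa>_kernel])
  also have "\<dots> = emeasure (density L\<^sub>1 F\<^sub>1) A"
    by (simp add: emeasure_density)
  finally show "emeasure (distr N M\<^sub>1 X) A = emeasure (density L\<^sub>1 F\<^sub>1) A" .
qed simp

lemma prob_space_marginal: "prob_space (density L\<^sub>1 F\<^sub>1)"
  unfolding marginal[symmetric]
  by (rule prob_space.prob_space_distr) (use N_prob N_def in auto)

lemma F\<^sub>1_integral: "(\<integral>\<^sup>+x. F\<^sub>1 x \<partial>L\<^sub>1) = 1"
  using prob_space_marginal by (simp add: prob_space_density_iff)

lemma AE_marginal_pos_finite: "AE x in density L\<^sub>1 F\<^sub>1. 0 < F\<^sub>1 x \<and> F\<^sub>1 x < \<top>"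
  using AE_density_pos[of F\<^sub>1 L\<^sub>1] AE_density_finite[of F\<^sub>1 L\<^sub>1] F\<^sub>1_integral by auto

text \<open>Computing the \<open>N\<close>-mass of rectangles once with \<open>K\<close> and once
  with \<open>\<kappa>\<close> gives the identity that the comparison of kernels asks for.
  \<open>K\<close> is an arbitrary version of the conditional law, so equality is only almost
  sure.\<close>

lemma AE_kernel:
  assumes K: "disintegrates N M\<^sub>1 X M\<^sub>2 Y K" and M\<^sub>2: "countably_generated M\<^sub>2"
  shows "AE x in density L\<^sub>1 F\<^sub>1. K x = density (\<kappa> x) (\<lambda>y. F (x, y) / F\<^sub>1 x)"
proof (rule AE_kernel_eq_density[OF \<kappa>_kernel _ _ F F\<^sub>1 _ M\<^sub>2])
  show "K \<in> M\<^sub>1 \<rightarrow>\<^sub>M prob_algebra M\<^sub>2"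
    using K by (simp add: disintegrates_def)
  fix A B assume [measurable]: "A \<in> sets M\<^sub>1" "B \<in> sets M\<^sub>2"
  let ?G = "\<lambda>z. indicator B (snd z) * indicator A (fst z) :: ennreal"
  have "(\<integral>\<^sup>+x. emeasure (K x) B * indicator A x \<partial>density L\<^sub>1 F\<^sub>1) =
      (\<integral>\<^sup>+x. \<integral>\<^sup>+y. ?G (x, y) \<partial>K x \<partial>distr N M\<^sub>1 X)"
    unfolding marginal
  proof (intro nn_integral_cong)
    fix x assume "x \<in> space (density L\<^sub>1 F\<^sub>1)"
    then have "B \<in> sets (K x)" using kernel_space[OF \<open>K \<in> _\<close>] by simp
    then show "emeasure (K x) B * indicator A x = (\<integral>\<^sup>+y. ?G (x, y) \<partial>K x)"
      by (simp add: nn_integral_multc)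
  qed
  also have "\<dots> = (\<integral>\<^sup>+\<omega>. ?G (X \<omega>, Y \<omega>) \<partial>N)"
    by (rule disintegrates_nn_integral[OF K, symmetric]) (auto simp: N_def)
  also have "\<dots> = (\<integral>\<^sup>+x. \<integral>\<^sup>+y. F (x, y) * ?G (x, y) \<partial>\<kappa> x \<partial>L\<^sub>1)"
    by (rule N_integral) measurable
  also have "\<dots> = (\<integral>\<^sup>+x. (\<integral>\<^sup>+y. F (x, y) * indicator B y \<partial>\<kappa> x) * indicator A x \<partial>L\<^sub>1)"
  proof (intro nn_integral_cong)
    fix x assume "x \<in> space L\<^sub>1"
    then have [measurable]: "(\<lambda>y. F (x, y)) \<in> borel_measurable (\<kappa> x)" "B \<in> sets (\<kappa> x)"
      using kernel_section_measurable[OF \<kappa>_kernel _ F] kernel_space[OF \<kappa>_kernel] by auto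
    show "(\<integral>\<^sup>+y. F (x, y) * ?G (x, y) \<partial>\<kappa> x) = (\<integral>\<^sup>+y. F (x, y) * indicator B y \<partial>\<kappa> x) * indicator A x"
      by (subst nn_integral_multc[symmetric]) (auto simp: mult.assoc)
  qed
  finally show "(\<integral>\<^sup>+x. emeasure (K x) B * indicator A x \<partial>density L\<^sub>1 F\<^sub>1) =
      (\<integral>\<^sup>+x. (\<integral>\<^sup>+y. F (x, y) * indicator B y \<partial>\<kappa> x) * indicator A x \<partial>L\<^sub>1)" .
qed (auto simp: F\<^sub>1_integral)

text \<open>Converse to the descriptions of marginal and kernel: together they determine the law of
  \<open>(X, Y)\<close>. Equality of \<open>Q\<close> and \<open>N\<close> themselves is not
  claimed, because in this context \<open>X\<close> and \<open>Y\<close> need not generate the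
  sigma-algebra of \<open>L\<close>.\<close>

lemma joint_law_eqI:
  assumes Q: "sets Q = sets L"
    and K: "disintegrates Q M\<^sub>1 X M\<^sub>2 Y K"
    and Q\<^sub>1: "distr Q M\<^sub>1 X = density L\<^sub>1 F\<^sub>1"
    and ae: "AE x in distr Q M\<^sub>1 X. K x = density (\<kappa> x) (\<lambda>y. F (x, y) / F\<^sub>1 x)"
  shows "distr Q (M\<^sub>1 \<Otimes>\<^sub>M M\<^sub>2) (\<lambda>\<omega>. (X \<omega>, Y \<omega>)) = distr N (M\<^sub>1 \<Otimes>\<^sub>M M\<^sub>2) (\<lambda>\<omega>. (X \<omega>, Y \<omega>))"
proof (rule measure_eqI)
  have [measurable]: "X \<in> Q \<rightarrow>\<^sub>M M\<^sub>1" "Y \<in> Q \<rightarrow>\<^sub>M M\<^sub>2"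
    using X Y Q by (simp_all cong: measurable_cong_sets)
  fix A assume "A \<in> sets (distr Q (M\<^sub>1 \<Otimes>\<^sub>M M\<^sub>2) (\<lambda>\<omega>. (X \<omega>, Y \<omega>)))"
  then have A[measurable]: "A \<in> sets (M\<^sub>1 \<Otimes>\<^sub>M M\<^sub>2)" by simp
  let ?I = "\<lambda>x. \<integral>\<^sup>+y. F (x, y) * indicator A (x, y) \<partial>\<kappa> x"
  have I_meas[measurable]: "?I \<in> borel_measurable M\<^sub>1"
    using kernel_integral_measurable[OF \<kappa>_kernel, of "\<lambda>z. F z * indicator A z"] by simp
  have sec[measurable]: "(\<lambda>y. F (x, y)) \<in> borel_measurable (\<kappa> x)"
    "(\<lambda>y. indicator A (x, y) :: ennreal) \<in> borel_measurable (\<kappa> x)" if "x \<in> space M\<^sub>1" for x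
    using that by (auto intro!: kernel_section_measurable[OF \<kappa>_kernel])
  have "emeasure (distr Q (M\<^sub>1 \<Otimes>\<^sub>M M\<^sub>2) (\<lambda>\<omega>. (X \<omega>, Y \<omega>))) A = (\<integral>\<^sup>+\<omega>. indicator A (X \<omega>, Y \<omega>) \<partial>Q)"
    by (rule emeasure_distr_eq_nn_integral) measurable
  also have "\<dots> = (\<integral>\<^sup>+x. \<integral>\<^sup>+y. indicator A (x, y) \<partial>K x \<partial>distr Q M\<^sub>1 X)"
    by (rule disintegrates_nn_integral[OF K]) measurable
  also have "\<dots> = (\<integral>\<^sup>+x. ?I x / F\<^sub>1 x \<partial>distr Q M\<^sub>1 X)"
    using ae
  proof (intro nn_integral_cong_AE, elim AE_mp, intro AE_I2 impI)
    fix x assume x: "x \<in> space (distr Q M\<^sub>1 X)" and eq: "K x = density (\<kappa> x) (\<lambda>y. F (x, y) / F\<^sub>1 x)"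
    have "(\<integral>\<^sup>+y. indicator A (x, y) \<partial>K x) = (\<integral>\<^sup>+y. F (x, y) / F\<^sub>1 x * indicator A (x, y) \<partial>\<kappa> x)"
      unfolding eq using x sec by (subst nn_integral_density) auto
    also have "\<dots> = (\<integral>\<^sup>+y. F (x, y) * indicator A (x, y) / F\<^sub>1 x \<partial>\<kappa> x)"
      by (intro nn_integral_cong) (auto split: split_indicator)
    also have "\<dots> = ?I x / F\<^sub>1 x"
      using x sec by (intro nn_integral_divide) auto
    finally show "(\<integral>\<^sup>+y. indicator A (x, y) \<partial>K x) = ?I x / F\<^sub>1 x" .
  qed
  also have "\<dots> = (\<integral>\<^sup>+x. F\<^sub>1 x * (?I x / F\<^sub>1 x) \<partial>L\<^sub>1)"
    unfolding Q\<^sub>1 by (subst nn_integral_density) measurable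
  also have "\<dots> = (\<integral>\<^sup>+x. ?I x \<partial>L\<^sub>1)"
  proof -
    have "AE x in L\<^sub>1. F\<^sub>1 x \<noteq> \<infinity>"
      by (rule nn_integral_PInf_AE) (auto simp: F\<^sub>1_integral)
    then show ?thesis
    proof (intro nn_integral_cong_AE, elim AE_mp, intro AE_I2 impI)
      fix x assume x: "x \<in> space L\<^sub>1" "F\<^sub>1 x \<noteq> \<infinity>"
      have "?I x \<le> F\<^sub>1 x"
        using x by (auto simp: F\<^sub>1 intro!: nn_integral_mono split: split_indicator)
      then show "F\<^sub>1 x * (?I x / F\<^sub>1 x) = ?I x"
        using x by (intro ennreal_mult_divide_cancel_le) (auto simp: top.not_eq_extremum)
    qed
  qed
  also have "\<dots> = (\<integral>\<^sup>+\<omega>. indicator A (X \<omega>, Y \<omega>) \<partial>N)"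
    by (rule N_integral[symmetric]) measurable
  also have "\<dots> = emeasure (distr N (M\<^sub>1 \<Otimes>\<^sub>M M\<^sub>2) (\<lambda>\<omega>. (X \<omega>, Y \<omega>))) A"
    by (rule emeasure_distr_eq_nn_integral[symmetric]) measurable
  finally show "emeasure (distr Q (M\<^sub>1 \<Otimes>\<^sub>M M\<^sub>2) (\<lambda>\<omega>. (X \<omega>, Y \<omega>))) A =
    emeasure (distr N (M\<^sub>1 \<Otimes>\<^sub>M M\<^sub>2) (\<lambda>\<omega>. (X \<omega>, Y \<omega>))) A" .
qed simp

lemma AE_pos_finite:
  "AE \<omega> in N. 0 < F (X \<omega>, Y \<omega>) \<and> F (X \<omega>, Y \<omega>) < \<top> \<and> 0 < F\<^sub>1 (X \<omega>) \<and> F\<^sub>1 (X \<omega>) < \<top>"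
proof -
  have "(\<integral>\<^sup>+\<omega>. F (X \<omega>, Y \<omega>) \<partial>L) = 1"
    using N_prob by (simp add: prob_space_density_iff)
  then have "AE \<omega> in N. 0 < F (X \<omega>, Y \<omega>) \<and> F (X \<omega>, Y \<omega>) < \<top>"
    using AE_density_pos[of "\<lambda>\<omega>. F (X \<omega>, Y \<omega>)" L] AE_density_finite[of "\<lambda>\<omega>. F (X \<omega>, Y \<omega>)" L]
    unfolding N_def by auto
  moreover have "AE \<omega> in N. 0 < F\<^sub>1 (X \<omega>) \<and> F\<^sub>1 (X \<omega>) < \<top>"
    using AE_marginal_pos_finite unfolding marginal[symmetric] by (subst (asm) AE_distr_iff) auto
  ultimately show ?thesis by auto
qed

text \<open>The marginal log-density is dominated by \<open>\<bar>ln F\<bar> + F\<^sub>1 / F + 1 / F\<^sub>1\<close>; the two quotients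
  have integral at most \<open>1\<close> each.\<close>

lemma integrable_ln_marginal:
  assumes int: "integrable N (\<lambda>\<omega>. ln (enn2real (F (X \<omega>, Y \<omega>))))"
  shows "integrable (density L\<^sub>1 F\<^sub>1) (\<lambda>x. ln (enn2real (F\<^sub>1 x)))"
proof -
  have [measurable]: "X \<in> N \<rightarrow>\<^sub>M M\<^sub>1" "Y \<in> N \<rightarrow>\<^sub>M M\<^sub>2" by (auto simp: N_def)
  let ?F = "\<lambda>\<omega>. F (X \<omega>, Y \<omega>)"
  \<comment> \<open>Under \<open>N\<close> the weight \<open>F\<close> cancels the denominator and
    leaves at most the total mass of \<open>F\<^sub>1\<close>; degenerate values of \<open>F\<close>
    only lower the integral. In \<open>q2\<close> the weight \<open>F\<^sub>1\<close> of the
    marginal law cancels in the same way.\<close>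
  have q1: "(\<integral>\<^sup>+\<omega>. F\<^sub>1 (X \<omega>) / ?F \<omega> \<partial>N) \<le> 1"
  proof -
    have "(\<integral>\<^sup>+\<omega>. F\<^sub>1 (X \<omega>) / ?F \<omega> \<partial>N) = (\<integral>\<^sup>+\<omega>. ?F \<omega> * (F\<^sub>1 (X \<omega>) / ?F \<omega>) \<partial>L)"
      unfolding N_def by (subst nn_integral_density) measurable
    also have "\<dots> \<le> (\<integral>\<^sup>+\<omega>. F\<^sub>1 (X \<omega>) \<partial>L)"
      by (intro nn_integral_mono ennreal_mult_divide_le)
    also have "\<dots> = (\<integral>\<^sup>+x. F\<^sub>1 x \<partial>L\<^sub>1)"
      unfolding L\<^sub>1_def by (subst nn_integral_distr) auto
    finally show ?thesis by (simp add: F\<^sub>1_integral)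
  qed
  have q2: "(\<integral>\<^sup>+\<omega>. 1 / F\<^sub>1 (X \<omega>) \<partial>N) \<le> 1"
  proof -
    have "(\<integral>\<^sup>+\<omega>. 1 / F\<^sub>1 (X \<omega>) \<partial>N) = (\<integral>\<^sup>+x. 1 / F\<^sub>1 x \<partial>distr N M\<^sub>1 X)"
      by (subst nn_integral_distr) auto
    also have "\<dots> = (\<integral>\<^sup>+x. F\<^sub>1 x * (1 / F\<^sub>1 x) \<partial>L\<^sub>1)"
      unfolding marginal by (subst nn_integral_density) measurable
    also have "\<dots> \<le> (\<integral>\<^sup>+x. 1 \<partial>L\<^sub>1)"
      by (intro nn_integral_mono ennreal_mult_divide_le)
    also have "\<dots> = 1"
      unfolding L\<^sub>1_def using prob_space.emeasure_space_1[OF prob_space.prob_space_distr[OF L X]] by simp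
    finally show ?thesis .
  qed
  have int': "(\<integral>\<^sup>+\<omega>. ennreal \<bar>ln (enn2real (?F \<omega>))\<bar> \<partial>N) < \<top>"
    using int unfolding integrable_iff_bounded by simp
  have "(\<integral>\<^sup>+\<omega>. ennreal \<bar>ln (enn2real (F\<^sub>1 (X \<omega>)))\<bar> \<partial>N) \<le>
      (\<integral>\<^sup>+\<omega>. ennreal \<bar>ln (enn2real (?F \<omega>))\<bar> + F\<^sub>1 (X \<omega>) / ?F \<omega> + 1 / F\<^sub>1 (X \<omega>) \<partial>N)"
    using AE_pos_finite
  proof (intro nn_integral_mono_AE, elim AE_mp, intro AE_I2 impI)
    fix \<omega> assume "0 < ?F \<omega> \<and> ?F \<omega> < \<top> \<and> 0 < F\<^sub>1 (X \<omega>) \<and> F\<^sub>1 (X \<omega>) < \<top>"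
    then obtain a b where ab: "F\<^sub>1 (X \<omega>) = ennreal a" "?F \<omega> = ennreal b" "a > 0" "b > 0"
      by (metis ennreal_pos_finiteE)
    have "ennreal \<bar>ln a\<bar> \<le> ennreal (\<bar>ln b\<bar> + a / b + 1 / a)"
      using abs_ln_le_quotients[OF ab(3,4)] by (rule ennreal_leI)
    also have "\<dots> = ennreal \<bar>ln b\<bar> + ennreal a / ennreal b + 1 / ennreal a"
      using ab divide_ennreal[of 1 a] by (simp add: divide_ennreal)
    finally show "ennreal \<bar>ln (enn2real (F\<^sub>1 (X \<omega>)))\<bar> \<le>
        ennreal \<bar>ln (enn2real (?F \<omega>))\<bar> + F\<^sub>1 (X \<omega>) / ?F \<omega> + 1 / F\<^sub>1 (X \<omega>)"
      using ab by simp
  qed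
  also have "\<dots> = (\<integral>\<^sup>+\<omega>. ennreal \<bar>ln (enn2real (?F \<omega>))\<bar> \<partial>N) +
      (\<integral>\<^sup>+\<omega>. F\<^sub>1 (X \<omega>) / ?F \<omega> \<partial>N) + (\<integral>\<^sup>+\<omega>. 1 / F\<^sub>1 (X \<omega>) \<partial>N)"
    by (simp add: nn_integral_add)
  also have "\<dots> \<le> (\<integral>\<^sup>+\<omega>. ennreal \<bar>ln (enn2real (?F \<omega>))\<bar> \<partial>N) + 1 + 1"
    by (intro add_mono q1 q2) simp
  also have "\<dots> < \<top>" using int' by simp
  finally have "integrable N (\<lambda>\<omega>. ln (enn2real (F\<^sub>1 (X \<omega>))))"
    unfolding integrable_iff_bounded by simp
  then show ?thesis
    unfolding marginal[symmetric] by (subst integrable_distr_eq) auto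
qed

text \<open>Under \<open>N\<close> the function \<open>ln (F / F\<^sub>1)\<close> is dominated by
  the sum of two integrable functions, and iterated integration along \<open>K\<close> leaves an
  integrable section for almost every \<open>x\<close>. This is the finiteness that the future
  problems need.\<close>

lemma AE_integrable_ln_kernel:
  assumes int: "integrable N (\<lambda>\<omega>. ln (enn2real (F (X \<omega>, Y \<omega>))))"
    and K: "disintegrates N M\<^sub>1 X M\<^sub>2 Y K"
  shows "AE x in density L\<^sub>1 F\<^sub>1. integrable (K x) (\<lambda>y. ln (enn2real (F (x, y) / F\<^sub>1 x)))"
proof -
  have [measurable]: "X \<in> N \<rightarrow>\<^sub>M M\<^sub>1" "Y \<in> N \<rightarrow>\<^sub>M M\<^sub>2" by (auto simp: N_def)
  have K': "K \<in> M\<^sub>1 \<rightarrow>\<^sub>M prob_algebra M\<^sub>2" using K by (simp add: disintegrates_def)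
  define l where "l = (\<lambda>z. ln (enn2real (F z / F\<^sub>1 (fst z))))"
  have l[measurable]: "l \<in> borel_measurable (M\<^sub>1 \<Otimes>\<^sub>M M\<^sub>2)" unfolding l_def by measurable
  \<comment> \<open>Valid for all extended values: if \<open>a\<close> or \<open>b\<close> is 0 or
    \<infinity>, so is the quotient, \<open>enn2real\<close> makes it 0, and
    \<open>ln 0 = 0\<close>.\<close>
  have bound: "\<bar>ln (enn2real (b / a))\<bar> \<le> \<bar>ln (enn2real b)\<bar> + \<bar>ln (enn2real a)\<bar>" for a b :: ennreal
  proof (cases "a = 0 \<or> a = \<top> \<or> b = 0 \<or> b = \<top>")
    case True
    then have "enn2real (b / a) = 0"
      by (auto simp: divide_ennreal_def ennreal_mult_eq_top_iff enn2real_eq_0_iff)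
    then show ?thesis by simp
  next
    case False
    then have "0 < a" "a < \<top>" "0 < b" "b < \<top>"
      by (auto simp: zero_less_iff_neq_zero top.not_eq_extremum)
    then obtain r s where "a = ennreal r" "b = ennreal s" "r > 0" "s > 0"
      by (metis ennreal_pos_finiteE)
    then show ?thesis by (simp add: divide_ennreal ln_div)
  qed
  have int\<^sub>1: "integrable N (\<lambda>\<omega>. ln (enn2real (F\<^sub>1 (X \<omega>))))"
    using integrable_ln_marginal[OF int] unfolding marginal[symmetric]
    by (subst (asm) integrable_distr_eq) auto
  have "integrable N (\<lambda>\<omega>. l (X \<omega>, Y \<omega>))"
  proof (rule Bochner_Integration.integrable_bound)
    show "integrable N (\<lambda>\<omega>. \<bar>ln (enn2real (F (X \<omega>, Y \<omega>)))\<bar> + \<bar>ln (enn2real (F\<^sub>1 (X \<omega>)))\<bar>)"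
      using int int\<^sub>1 by auto
  qed (use bound in \<open>auto simp: l_def\<close>)
  then have "(\<integral>\<^sup>+\<omega>. ennreal \<bar>l (X \<omega>, Y \<omega>)\<bar> \<partial>N) < \<top>"
    unfolding integrable_iff_bounded by simp
  also have "(\<integral>\<^sup>+\<omega>. ennreal \<bar>l (X \<omega>, Y \<omega>)\<bar> \<partial>N) =
      (\<integral>\<^sup>+x. \<integral>\<^sup>+y. ennreal \<bar>l (x, y)\<bar> \<partial>K x \<partial>density L\<^sub>1 F\<^sub>1)"
    unfolding marginal[symmetric]
    by (rule disintegrates_nn_integral[OF K, of "\<lambda>z. ennreal \<bar>l z\<bar>"]) measurable
  finally have fin: "(\<integral>\<^sup>+x. \<integral>\<^sup>+y. ennreal \<bar>l (x, y)\<bar> \<partial>K x \<partial>density L\<^sub>1 F\<^sub>1) < \<top>" .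
  have "(\<lambda>x. \<integral>\<^sup>+y. ennreal \<bar>l (x, y)\<bar> \<partial>K x) \<in> borel_measurable M\<^sub>1"
    using kernel_integral_measurable[OF K', of "\<lambda>z. ennreal \<bar>l z\<bar>"] by simp
  then have "AE x in density L\<^sub>1 F\<^sub>1. (\<integral>\<^sup>+y. ennreal \<bar>l (x, y)\<bar> \<partial>K x) \<noteq> \<infinity>"
    using fin by (intro nn_integral_PInf_AE) auto
  then show ?thesis
  proof (elim AE_mp, intro AE_I2 impI)
    fix x assume "x \<in> space (density L\<^sub>1 F\<^sub>1)" and fin: "(\<integral>\<^sup>+y. ennreal \<bar>l (x, y)\<bar> \<partial>K x) \<noteq> \<infinity>"
    then have x: "x \<in> space M\<^sub>1" by simp
    then have "(\<lambda>y. l (x, y)) \<in> borel_measurable (K x)"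
      using kernel_space[OF K' x] by (simp cong: measurable_cong_sets)
    with fin have "integrable (K x) (\<lambda>y. l (x, y))"
      unfolding integrable_iff_bounded by (simp add: top.not_eq_extremum)
    then show "integrable (K x) (\<lambda>y. ln (enn2real (F (x, y) / F\<^sub>1 x)))"
      by (simp add: l_def)
  qed
qed

end

section \<open>Minimisers and disintegration\<close>

text \<open>The derivative is taken between the images under \<open>Z\<close> and pulled back, which
  replaces a factorisation of \<open>Z\<close>-measurable functions. By \<open>gen\<close> the
  images determine the measures, so the pulled-back function is a density of
  \<open>\<mu>\<close>.\<close>

lemma density_factorisation:
  assumes r: "prob_space r" and \<mu>: "prob_space \<mu>" "sets \<mu> = sets r" "absolutely_continuous r \<mu>"
    and Z[measurable]: "Z \<in> r \<rightarrow>\<^sub>M N"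
    and gen: "\<And>A. A \<in> sets r \<Longrightarrow> \<exists>B\<in>sets N. A = Z -` B \<inter> space r"
  obtains H where "H \<in> borel_measurable N" "\<mu> = density r (\<lambda>z. H (Z z))"
proof -
  have [measurable]: "Z \<in> \<mu> \<rightarrow>\<^sub>M N"
    using Z \<mu>(2) by (simp cong: measurable_cong_sets)
  have sp: "space \<mu> = space r" using \<mu>(2) by (rule sets_eq_imp_space_eq)
  interpret Z: prob_space "distr r N Z"
    by (rule prob_space.prob_space_distr[OF r]) measurable
  have ac: "absolutely_continuous (distr r N Z) (distr \<mu> N Z)"
    unfolding absolutely_continuous_def
  proof
    fix A assume "A \<in> null_sets (distr r N Z)"
    then have "A \<in> sets N" "Z -` A \<inter> space r \<in> null_sets r"
      by (auto simp: null_sets_distr_iff)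
    then show "A \<in> null_sets (distr \<mu> N Z)"
      using \<mu>(3) by (auto simp: null_sets_distr_iff absolutely_continuous_def sp)
  qed
  define H where "H = RN_deriv (distr r N Z) (distr \<mu> N Z)"
  have H[measurable]: "H \<in> borel_measurable N"
    unfolding H_def using borel_measurable_RN_deriv[of "distr r N Z"] by simp
  have "density (distr r N Z) H = distr \<mu> N Z"
    unfolding H_def by (rule Z.density_RN_deriv[OF ac]) simp
  then have "distr (density r (\<lambda>z. H (Z z))) N Z = distr \<mu> N Z"
    by (simp add: distr_density_comp)
  then have "\<mu> = density r (\<lambda>z. H (Z z))"
    by (intro measure_eqI_distr[OF _ _ Z gen]) (auto simp: \<mu>(2))
  with H show ?thesis by (rule that)
qed

text \<open>The kernel sees the past only through \<open>f\<^sub>1\<close>. Hence the disintegration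
  descends to the image under \<open>f\<close>, with the kernel pushed forward by
  \<open>f\<^sub>2\<close>; a kernel depending on more of the past would first have to be averaged
  over it.\<close>

lemma disintegrates_distr:
  assumes R: "prob_space R" and X[measurable]: "X \<in> R \<rightarrow>\<^sub>M S\<^sub>1" and Y[measurable]: "Y \<in> R \<rightarrow>\<^sub>M S\<^sub>2"
    and f[measurable]: "f \<in> R \<rightarrow>\<^sub>M E"
    and f\<^sub>1[measurable]: "f\<^sub>1 \<in> S\<^sub>1 \<rightarrow>\<^sub>M E\<^sub>1" and f\<^sub>2[measurable]: "f\<^sub>2 \<in> S\<^sub>2 \<rightarrow>\<^sub>M E\<^sub>2"
    and e\<^sub>1[measurable]: "e\<^sub>1 \<in> E \<rightarrow>\<^sub>M E\<^sub>1" and e\<^sub>2[measurable]: "e\<^sub>2 \<in> E \<rightarrow>\<^sub>M E\<^sub>2"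
    and comm: "\<And>\<omega>. \<omega> \<in> space R \<Longrightarrow> e\<^sub>1 (f \<omega>) = f\<^sub>1 (X \<omega>)" "\<And>\<omega>. \<omega> \<in> space R \<Longrightarrow> e\<^sub>2 (f \<omega>) = f\<^sub>2 (Y \<omega>)"
    and \<kappa>[measurable]: "\<kappa> \<in> E\<^sub>1 \<rightarrow>\<^sub>M prob_algebra S\<^sub>2"
    and dis: "disintegrates R S\<^sub>1 X S\<^sub>2 Y (\<lambda>x. \<kappa> (f\<^sub>1 x))"
  shows "disintegrates (distr R E f) E\<^sub>1 e\<^sub>1 E\<^sub>2 e\<^sub>2 (\<lambda>z. distr (\<kappa> z) E\<^sub>2 f\<^sub>2)"
proof (rule disintegratesI_nn_integral)
  show "prob_space (distr R E f)"
    by (rule prob_space.prob_space_distr[OF R f])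
  fix G :: "'e \<times> 'f \<Rightarrow> ennreal" assume G[measurable]: "G \<in> borel_measurable (E\<^sub>1 \<Otimes>\<^sub>M E\<^sub>2)"
  let ?I = "\<lambda>z. \<integral>\<^sup>+w. G (z, w) \<partial>distr (\<kappa> z) E\<^sub>2 f\<^sub>2"
  have kernel: "(\<lambda>z. distr (\<kappa> z) E\<^sub>2 f\<^sub>2) \<in> E\<^sub>1 \<rightarrow>\<^sub>M prob_algebra E\<^sub>2" by measurable
  have [measurable]: "?I \<in> borel_measurable E\<^sub>1"
    by (rule kernel_integral_measurable[OF kernel G])
  have I: "?I z = (\<integral>\<^sup>+y. G (z, f\<^sub>2 y) \<partial>\<kappa> z)" if z: "z \<in> space E\<^sub>1" for z
  proof (rule nn_integral_distr)
    show "f\<^sub>2 \<in> \<kappa> z \<rightarrow>\<^sub>M E\<^sub>2"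
      using f\<^sub>2 kernel_space[OF \<kappa> z] by (simp cong: measurable_cong_sets)
  qed (use z in measurable)
  have "(\<integral>\<^sup>+z. G (e\<^sub>1 z, e\<^sub>2 z) \<partial>distr R E f) = (\<integral>\<^sup>+\<omega>. G (e\<^sub>1 (f \<omega>), e\<^sub>2 (f \<omega>)) \<partial>R)"
    by (rule nn_integral_distr) measurable
  also have "\<dots> = (\<integral>\<^sup>+\<omega>. (\<lambda>z. G (f\<^sub>1 (fst z), f\<^sub>2 (snd z))) (X \<omega>, Y \<omega>) \<partial>R)"
    by (intro nn_integral_cong) (simp add: comm)
  also have "\<dots> = (\<integral>\<^sup>+x. \<integral>\<^sup>+y. G (f\<^sub>1 x, f\<^sub>2 y) \<partial>\<kappa> (f\<^sub>1 x) \<partial>distr R S\<^sub>1 X)"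
    by (subst disintegrates_nn_integral[OF dis]) auto
  also have "\<dots> = (\<integral>\<^sup>+x. ?I (f\<^sub>1 x) \<partial>distr R S\<^sub>1 X)"
    by (intro nn_integral_cong I[symmetric]) (use measurable_space[OF f\<^sub>1] in auto)
  also have "\<dots> = (\<integral>\<^sup>+\<omega>. ?I (f\<^sub>1 (X \<omega>)) \<partial>R)"
    by (rule nn_integral_distr) measurable
  also have "\<dots> = (\<integral>\<^sup>+\<omega>. ?I (e\<^sub>1 (f \<omega>)) \<partial>R)"
    by (intro nn_integral_cong) (simp add: comm)
  also have "\<dots> = (\<integral>\<^sup>+z. ?I (e\<^sub>1 z) \<partial>distr R E f)"
    by (rule nn_integral_distr[symmetric]) measurable
  also have "\<dots> = (\<integral>\<^sup>+z. ?I z \<partial>distr (distr R E f) E\<^sub>1 e\<^sub>1)"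
    by (rule nn_integral_distr[symmetric]) measurable
  finally show "(\<integral>\<^sup>+z. G (e\<^sub>1 z, e\<^sub>2 z) \<partial>distr R E f) = (\<integral>\<^sup>+z. ?I z \<partial>distr (distr R E f) E\<^sub>1 e\<^sub>1)" .
qed measurable

text \<open>Paths and grids enter only through measurable maps: \<open>X\<close>, \<open>Y\<close>
  and \<open>e\<^sub>1\<close>, \<open>e\<^sub>2\<close> are past and future parts of a path and of
  a grid vector, \<open>f\<close>, \<open>f\<^sub>1\<close>, \<open>f\<^sub>2\<close> the grid
  projections, \<open>comm\<close> the commuting squares. Each minimisation condition becomes an
  equation between a measure and a density, after which entropy no longer occurs.\<close>

lemma minimises_entropy_disintegration_iff:
  fixes S :: "'w measure" and S\<^sub>1 :: "'x measure" and S\<^sub>2 :: "'y measure"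
    and E :: "'z measure" and E\<^sub>1 :: "'u measure" and E\<^sub>2 :: "'v measure"
  assumes X: "X \<in> S \<rightarrow>\<^sub>M S\<^sub>1" and Y: "Y \<in> S \<rightarrow>\<^sub>M S\<^sub>2" and f: "f \<in> S \<rightarrow>\<^sub>M E"
    and f\<^sub>1[measurable]: "f\<^sub>1 \<in> S\<^sub>1 \<rightarrow>\<^sub>M E\<^sub>1" and f\<^sub>2[measurable]: "f\<^sub>2 \<in> S\<^sub>2 \<rightarrow>\<^sub>M E\<^sub>2"
    and e\<^sub>1[measurable]: "e\<^sub>1 \<in> E \<rightarrow>\<^sub>M E\<^sub>1" and e\<^sub>2[measurable]: "e\<^sub>2 \<in> E \<rightarrow>\<^sub>M E\<^sub>2"
    and comm: "\<And>\<omega>. \<omega> \<in> space S \<Longrightarrow> e\<^sub>1 (f \<omega>) = f\<^sub>1 (X \<omega>)" "\<And>\<omega>. \<omega> \<in> space S \<Longrightarrow> e\<^sub>2 (f \<omega>) = f\<^sub>2 (Y \<omega>)"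
    and gen_S: "\<And>A. A \<in> sets S \<Longrightarrow> \<exists>B\<in>sets (S\<^sub>1 \<Otimes>\<^sub>M S\<^sub>2). A = (\<lambda>\<omega>. (X \<omega>, Y \<omega>)) -` B \<inter> space S"
    and gen_E: "\<And>A. A \<in> sets E \<Longrightarrow> \<exists>B\<in>sets (E\<^sub>1 \<Otimes>\<^sub>M E\<^sub>2). A = (\<lambda>z. (e\<^sub>1 z, e\<^sub>2 z)) -` B \<inter> space E"
    and cg: "countably_generated S\<^sub>2" "countably_generated E\<^sub>2"
    and R: "R \<in> space (prob_algebra S)" and P: "P \<in> space (prob_algebra S)" "distr P E f = \<mu>"
    and \<mu>: "\<mu> \<in> space (prob_algebra E)" "absolutely_continuous (distr R E f) \<mu>"
      "rel_entropy \<mu> (distr R E f) < \<infinity>"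
    and P_fut: "disintegrates P S\<^sub>1 X S\<^sub>2 Y P_fut"
    and R_fut: "R_fut \<in> E\<^sub>1 \<rightarrow>\<^sub>M prob_algebra S\<^sub>2" "disintegrates R S\<^sub>1 X S\<^sub>2 Y (\<lambda>x. R_fut (f\<^sub>1 x))"
    and \<mu>_fut: "disintegrates \<mu> E\<^sub>1 e\<^sub>1 E\<^sub>2 e\<^sub>2 \<mu>_fut"
  shows "minimises_entropy (laws_with_image S E f \<mu>) R P \<longleftrightarrow>
    minimises_entropy (laws_with_image S\<^sub>1 E\<^sub>1 f\<^sub>1 (distr \<mu> E\<^sub>1 e\<^sub>1)) (distr R S\<^sub>1 X) (distr P S\<^sub>1 X) \<and>
    (AE x in distr P S\<^sub>1 X. minimises_entropy (laws_with_image S\<^sub>2 E\<^sub>2 f\<^sub>2 (\<mu>_fut (f\<^sub>1 x))) (R_fut (f\<^sub>1 x)) (P_fut x))"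
proof -
  have sets: "sets R = sets S" "sets P = sets S" "sets \<mu> = sets E"
    and R_prob: "prob_space R" and P_prob: "prob_space P" and \<mu>_prob: "prob_space \<mu>"
    using R P \<mu> by (auto simp: space_prob_algebra)
  have [simp]: "space R = space S" "space P = space S" "space \<mu> = space E"
    using sets by (auto dest: sets_eq_imp_space_eq)
  have XR[measurable]: "X \<in> R \<rightarrow>\<^sub>M S\<^sub>1" and YR[measurable]: "Y \<in> R \<rightarrow>\<^sub>M S\<^sub>2" and fR[measurable]: "f \<in> R \<rightarrow>\<^sub>M E"
    and XP[measurable]: "X \<in> P \<rightarrow>\<^sub>M S\<^sub>1" and YP[measurable]: "Y \<in> P \<rightarrow>\<^sub>M S\<^sub>2" and fP[measurable]: "f \<in> P \<rightarrow>\<^sub>M E"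
    using X Y f sets by (simp_all cong: measurable_cong_sets)
  define r where "r = distr R E f"
  have r_prob: "prob_space r"
    unfolding r_def by (rule prob_space.prob_space_distr[OF R_prob]) measurable
  have [measurable_cong, simp]: "sets r = sets E" and [simp]: "space r = space E" by (simp_all add: r_def)
  have \<mu>_ac: "absolutely_continuous r \<mu>" using \<mu>(2) by (simp add: r_def)
  have e_meas: "(\<lambda>z. (e\<^sub>1 z, e\<^sub>2 z)) \<in> r \<rightarrow>\<^sub>M E\<^sub>1 \<Otimes>\<^sub>M E\<^sub>2" by measurable
  \<comment> \<open>\<open>H\<close> lives on pairs of a past and a future grid vector and not on
    \<open>E\<close>, so that it has sections in the second variable.\<close>
  obtain H where H[measurable]: "H \<in> borel_measurable (E\<^sub>1 \<Otimes>\<^sub>M E\<^sub>2)"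
    and \<mu>_H: "\<mu> = density r (\<lambda>z. H (e\<^sub>1 z, e\<^sub>2 z))"
    by (rule density_factorisation[OF r_prob \<mu>_prob _ \<mu>_ac e_meas]) (use sets gen_E in auto)
  define \<rho> where "\<rho> = (\<lambda>z. distr (R_fut z) E\<^sub>2 f\<^sub>2)"
  have dis_r: "disintegrates r E\<^sub>1 e\<^sub>1 E\<^sub>2 e\<^sub>2 \<rho>"
    unfolding r_def \<rho>_def
    by (rule disintegrates_distr[OF R_prob XR YR fR f\<^sub>1 f\<^sub>2 e\<^sub>1 e\<^sub>2 _ _ R_fut]) (simp_all add: comm)
  define H\<^sub>1 where "H\<^sub>1 = (\<lambda>z. \<integral>\<^sup>+w. H (z, w) \<partial>\<rho> z)"
  interpret r: density_disintegration r E\<^sub>1 e\<^sub>1 E\<^sub>2 e\<^sub>2 \<rho> H H\<^sub>1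
  proof (rule density_disintegration.intro)
    show "prob_space (density r (\<lambda>z. H (e\<^sub>1 z, e\<^sub>2 z)))"
      using \<mu>_prob unfolding \<mu>_H .
  qed (simp_all add: r_prob dis_r H\<^sub>1_def)
  have r_N: "r.N = \<mu>" by (simp add: r.N_def \<mu>_H)
  have f\<^sub>2_R_fut: "f\<^sub>2 \<in> R_fut z \<rightarrow>\<^sub>M E\<^sub>2" if "z \<in> space E\<^sub>1" for z
    using f\<^sub>2 kernel_space[OF R_fut(1) that] by (simp cong: measurable_cong_sets)
  \<comment> \<open>On paths the marginal density is the same \<open>H\<^sub>1\<close>, now composed
    with \<open>f\<^sub>1\<close>: integrating a function of \<open>f\<^sub>2\<close> over
    \<open>R_fut\<close> is integrating over its image \<open>\<rho>\<close>.\<close>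
  interpret R: density_disintegration R S\<^sub>1 X S\<^sub>2 Y "\<lambda>x. R_fut (f\<^sub>1 x)" "\<lambda>z. H (f\<^sub>1 (fst z), f\<^sub>2 (snd z))" "\<lambda>x. H\<^sub>1 (f\<^sub>1 x)"
  proof (rule density_disintegration.intro)
    fix x assume "x \<in> space S\<^sub>1"
    then have z: "f\<^sub>1 x \<in> space E\<^sub>1" using measurable_space[OF f\<^sub>1] by auto
    show "H\<^sub>1 (f\<^sub>1 x) = (\<integral>\<^sup>+y. H (f\<^sub>1 (fst (x, y)), f\<^sub>2 (snd (x, y))) \<partial>R_fut (f\<^sub>1 x))"
      unfolding H\<^sub>1_def \<rho>_def fst_conv snd_conv
      by (rule nn_integral_distr[OF f\<^sub>2_R_fut[OF z]]) (use z in measurable)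
  next
    have "(\<integral>\<^sup>+\<omega>. H (f\<^sub>1 (X \<omega>), f\<^sub>2 (Y \<omega>)) \<partial>R) = (\<integral>\<^sup>+\<omega>. H (e\<^sub>1 (f \<omega>), e\<^sub>2 (f \<omega>)) \<partial>R)"
      by (intro nn_integral_cong) (simp add: comm)
    also have "\<dots> = (\<integral>\<^sup>+z. H (e\<^sub>1 z, e\<^sub>2 z) \<partial>r)"
      unfolding r_def by (subst nn_integral_distr) auto
    also have "\<dots> = 1"
      using \<mu>_prob unfolding \<mu>_H by (simp add: prob_space_density_iff)
    finally show "prob_space (density R (\<lambda>\<omega>. H (f\<^sub>1 (fst (X \<omega>, Y \<omega>)), f\<^sub>2 (snd (X \<omega>, Y \<omega>)))))"
      by (simp add: prob_space_density_iff)
  qed (simp_all add: R_prob R_fut)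
  have R_N: "R.N = density R (\<lambda>\<omega>. H (e\<^sub>1 (f \<omega>), e\<^sub>2 (f \<omega>)))"
    unfolding R.N_def by (intro density_cong) (auto simp: comm)
  \<comment> \<open>Finite entropy of \<open>\<mu>\<close> enters here: a log-density that is not
    integrable would make it \<infinity>.\<close>
  have int: "integrable \<mu> (\<lambda>z. ln (enn2real (H (e\<^sub>1 z, e\<^sub>2 z))))"
  proof (rule ccontr)
    assume "\<not> ?thesis"
    then have "rel_entropy \<mu> r = \<infinity>"
      unfolding \<mu>_H by (intro rel_entropy_density_not_integrable[OF r_prob]) auto
    with \<mu>(3) show False by (simp add: r_def)
  qed
  have r_L\<^sub>1: "r.L\<^sub>1 = distr R.L\<^sub>1 E\<^sub>1 f\<^sub>1"
    unfolding r.L\<^sub>1_def R.L\<^sub>1_def unfolding r_def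
    by (auto simp: distr_distr comp_def comm intro!: distr_cong)
  have \<mu>\<^sub>1: "distr \<mu> E\<^sub>1 e\<^sub>1 = density r.L\<^sub>1 H\<^sub>1"
    using r.marginal r_N by simp
  have \<mu>\<^sub>1_P: "distr \<mu> E\<^sub>1 e\<^sub>1 = distr (distr P S\<^sub>1 X) E\<^sub>1 f\<^sub>1"
    unfolding P(2)[symmetric] by (auto simp: distr_distr comp_def comm intro!: distr_cong)

  have whole: "minimises_entropy (laws_with_image S E f \<mu>) R P \<longleftrightarrow> P = R.N"
    unfolding R_N
    by (rule minimises_entropy_iff_density[OF R f _ _ \<mu>_prob int])
       (use e_meas \<mu>_H in \<open>auto simp: r_def\<close>)
  have past: "minimises_entropy (laws_with_image S\<^sub>1 E\<^sub>1 f\<^sub>1 (distr \<mu> E\<^sub>1 e\<^sub>1)) (distr R S\<^sub>1 X) (distr P S\<^sub>1 X)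
    \<longleftrightarrow> distr P S\<^sub>1 X = density R.L\<^sub>1 (\<lambda>x. H\<^sub>1 (f\<^sub>1 x))"
    unfolding R.L\<^sub>1_def[symmetric]
  proof (rule minimises_entropy_iff_density)
    show "R.L\<^sub>1 \<in> space (prob_algebra S\<^sub>1)"
      unfolding R.L\<^sub>1_def using prob_space.prob_space_distr[OF R_prob XR] by (simp add: space_prob_algebra)
    show "distr \<mu> E\<^sub>1 e\<^sub>1 = density (distr R.L\<^sub>1 E\<^sub>1 f\<^sub>1) H\<^sub>1"
      by (simp add: \<mu>\<^sub>1 r_L\<^sub>1)
    show "prob_space (distr \<mu> E\<^sub>1 e\<^sub>1)"
      using r.prob_space_marginal by (simp add: \<mu>\<^sub>1)
    show "integrable (distr \<mu> E\<^sub>1 e\<^sub>1) (\<lambda>z. ln (enn2real (H\<^sub>1 z)))"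
      unfolding \<mu>\<^sub>1 using r.integrable_ln_marginal int by (simp add: r_N)
  qed measurable
  \<comment> \<open>Valid for almost every past whether or not \<open>P\<close> is a minimiser: the
    past grid law of \<open>P\<close> is the marginal of \<open>\<mu>\<close>, so null sets of past
    grid vectors pull back to null sets of pasts. Off them the prescribed image
    \<open>\<mu>_fut\<close> has the expected density, with integrable logarithm.\<close>
  have future: "AE x in distr P S\<^sub>1 X.
    minimises_entropy (laws_with_image S\<^sub>2 E\<^sub>2 f\<^sub>2 (\<mu>_fut (f\<^sub>1 x))) (R_fut (f\<^sub>1 x)) (P_fut x) \<longleftrightarrow>
    P_fut x = density (R_fut (f\<^sub>1 x)) (\<lambda>y. H (f\<^sub>1 x, f\<^sub>2 y) / H\<^sub>1 (f\<^sub>1 x))"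
  proof -
    have "AE z in distr \<mu> E\<^sub>1 e\<^sub>1. \<mu>_fut z = density (\<rho> z) (\<lambda>w. H (z, w) / H\<^sub>1 z)"
      unfolding \<mu>\<^sub>1 by (rule r.AE_kernel) (use \<mu>_fut r_N cg in auto)
    moreover have "AE z in distr \<mu> E\<^sub>1 e\<^sub>1. integrable (\<mu>_fut z) (\<lambda>w. ln (enn2real (H (z, w) / H\<^sub>1 z)))"
      unfolding \<mu>\<^sub>1 by (rule r.AE_integrable_ln_kernel) (use \<mu>_fut r_N int in auto)
    ultimately have "AE z in distr (distr P S\<^sub>1 X) E\<^sub>1 f\<^sub>1. \<mu>_fut z = density (\<rho> z) (\<lambda>w. H (z, w) / H\<^sub>1 z) \<and>
        integrable (\<mu>_fut z) (\<lambda>w. ln (enn2real (H (z, w) / H\<^sub>1 z)))"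
      unfolding \<mu>\<^sub>1_P by auto
    then have "AE x in distr P S\<^sub>1 X. \<mu>_fut (f\<^sub>1 x) = density (\<rho> (f\<^sub>1 x)) (\<lambda>w. H (f\<^sub>1 x, w) / H\<^sub>1 (f\<^sub>1 x)) \<and>
        integrable (\<mu>_fut (f\<^sub>1 x)) (\<lambda>w. ln (enn2real (H (f\<^sub>1 x, w) / H\<^sub>1 (f\<^sub>1 x))))"
      by (rule AE_distrD[rotated]) measurable
    then show ?thesis
    proof (elim AE_mp, intro AE_I2 impI)
      fix x assume "x \<in> space (distr P S\<^sub>1 X)"
        and ae: "\<mu>_fut (f\<^sub>1 x) = density (\<rho> (f\<^sub>1 x)) (\<lambda>w. H (f\<^sub>1 x, w) / H\<^sub>1 (f\<^sub>1 x)) \<and>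
          integrable (\<mu>_fut (f\<^sub>1 x)) (\<lambda>w. ln (enn2real (H (f\<^sub>1 x, w) / H\<^sub>1 (f\<^sub>1 x))))"
      then have z[measurable]: "f\<^sub>1 x \<in> space E\<^sub>1" using measurable_space[OF f\<^sub>1] by auto
      have \<mu>_fut': "\<mu>_fut \<in> E\<^sub>1 \<rightarrow>\<^sub>M prob_algebra E\<^sub>2" using \<mu>_fut by (simp add: disintegrates_def)
      show "minimises_entropy (laws_with_image S\<^sub>2 E\<^sub>2 f\<^sub>2 (\<mu>_fut (f\<^sub>1 x))) (R_fut (f\<^sub>1 x)) (P_fut x) \<longleftrightarrow>
        P_fut x = density (R_fut (f\<^sub>1 x)) (\<lambda>y. H (f\<^sub>1 x, f\<^sub>2 y) / H\<^sub>1 (f\<^sub>1 x))"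
      proof (rule minimises_entropy_iff_density)
        show "R_fut (f\<^sub>1 x) \<in> space (prob_algebra S\<^sub>2)"
          by (rule measurable_space[OF R_fut(1) z])
        show "prob_space (\<mu>_fut (f\<^sub>1 x))" by (rule kernel_space[OF \<mu>_fut' z])
      qed (use ae in \<open>auto simp: \<rho>_def\<close>)
    qed
  qed
  have "P = R.N \<longleftrightarrow> distr P S\<^sub>1 X = density R.L\<^sub>1 (\<lambda>x. H\<^sub>1 (f\<^sub>1 x)) \<and>
    (AE x in distr P S\<^sub>1 X. P_fut x = density (R_fut (f\<^sub>1 x)) (\<lambda>y. H (f\<^sub>1 x, f\<^sub>2 y) / H\<^sub>1 (f\<^sub>1 x)))"
  proof (intro iffI conjI; (elim conjE)?)
    assume P_N: "P = R.N"
    then show *: "distr P S\<^sub>1 X = density R.L\<^sub>1 (\<lambda>x. H\<^sub>1 (f\<^sub>1 x))"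
      using R.marginal by simp
    show "AE x in distr P S\<^sub>1 X. P_fut x = density (R_fut (f\<^sub>1 x)) (\<lambda>y. H (f\<^sub>1 x, f\<^sub>2 y) / H\<^sub>1 (f\<^sub>1 x))"
      using R.AE_kernel[OF P_fut[unfolded P_N] cg(1)] unfolding * by simp
  next
    assume "distr P S\<^sub>1 X = density R.L\<^sub>1 (\<lambda>x. H\<^sub>1 (f\<^sub>1 x))"
      "AE x in distr P S\<^sub>1 X. P_fut x = density (R_fut (f\<^sub>1 x)) (\<lambda>y. H (f\<^sub>1 x, f\<^sub>2 y) / H\<^sub>1 (f\<^sub>1 x))"
    then have "distr P (S\<^sub>1 \<Otimes>\<^sub>M S\<^sub>2) (\<lambda>\<omega>. (X \<omega>, Y \<omega>)) = distr R.N (S\<^sub>1 \<Otimes>\<^sub>M S\<^sub>2) (\<lambda>\<omega>. (X \<omega>, Y \<omega>))"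
      by (intro R.joint_law_eqI[OF _ P_fut]) (simp_all add: sets)
    \<comment> \<open>Past and future together determine the path, in the form of
      \<open>gen_S\<close>, so equality of joint laws lifts to \<open>S\<close>.\<close>
    then show "P = R.N"
      by (rule measure_eqI_distr[OF _ _ _ gen_S, rotated -1]) (use X Y sets in auto)
  qed
  moreover have "(AE x in distr P S\<^sub>1 X.
      minimises_entropy (laws_with_image S\<^sub>2 E\<^sub>2 f\<^sub>2 (\<mu>_fut (f\<^sub>1 x))) (R_fut (f\<^sub>1 x)) (P_fut x)) \<longleftrightarrow>
    (AE x in distr P S\<^sub>1 X. P_fut x = density (R_fut (f\<^sub>1 x)) (\<lambda>y. H (f\<^sub>1 x, f\<^sub>2 y) / H\<^sub>1 (f\<^sub>1 x)))"
    using future by (rule eventually_subst)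
  ultimately show ?thesis
    unfolding whole past by simp
qed

section \<open>Path spaces\<close>

text \<open>On \<open>\<Omega>\<close> each coordinate is a pointwise limit of coordinates from the
  countable set \<open>J\<close>, so these and a countable basis of the value space suffice. The
  sequence in \<open>approx\<close> must not depend on the path; otherwise the limit would not be a
  limit of measurable functions.\<close>

lemma countably_generated_restrict_PiM:
  fixes \<Omega> :: "('i \<Rightarrow> 'a::{second_countable_topology, metric_space}) set"
  assumes \<Omega>: "\<Omega> \<subseteq> extensional I" and J: "countable J" "J \<subseteq> I"
    and approx: "\<And>u. u \<in> I \<Longrightarrow> \<exists>q :: nat \<Rightarrow> 'i. range q \<subseteq> J \<and> (\<forall>\<omega>\<in>\<Omega>. (\<lambda>n. \<omega> (q n)) \<longlonglongrightarrow> \<omega> u)"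
  shows "countably_generated (restrict_space (PiM I (\<lambda>_. borel)) \<Omega>)"
proof -
  let ?M = "restrict_space (PiM I (\<lambda>_. borel :: 'a measure)) \<Omega>"
  obtain B :: "'a set set" where B: "countable B" "topological_basis B"
    using ex_countable_basis by auto
  have sp: "space ?M = \<Omega>"
    using \<Omega> by (auto simp: space_restrict_space space_PiM PiE_def)
  define G where "G = (\<lambda>(u, b). {\<omega> \<in> \<Omega>. \<omega> u \<in> b}) ` (J \<times> B)"
  have G: "G \<subseteq> Pow \<Omega>" by (auto simp: G_def)
  have "countable G"
    unfolding G_def using J(1) B(1) by auto
  moreover have "sets ?M = sigma_sets \<Omega> G"
  proof
    have comp: "(\<lambda>\<omega>. \<omega> u) \<in> ?M \<rightarrow>\<^sub>M borel" if "u \<in> I" for u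
      using that by (intro measurable_restrict_space1 measurable_component_singleton)
    have "G \<subseteq> sets ?M"
    proof
      fix A assume "A \<in> G"
      then obtain u b where ub: "u \<in> J" "b \<in> B" "A = (\<lambda>\<omega>. \<omega> u) -` b \<inter> space ?M"
        unfolding G_def sp by auto
      then show "A \<in> sets ?M"
        using measurable_sets[OF comp] J(2) topological_basis_open[OF B(2)] by auto
    qed
    then show "sigma_sets \<Omega> G \<subseteq> sets ?M"
      using sets.sigma_sets_subset[of G ?M] sp by simp
    let ?N = "sigma \<Omega> G"
    have spN: "space ?N = \<Omega>" and setsN: "sets ?N = sigma_sets \<Omega> G"
      using G by simp_all
    have J_meas: "(\<lambda>\<omega>. \<omega> u) \<in> ?N \<rightarrow>\<^sub>M borel" if "u \<in> J" for u
      unfolding borel_eq_countable_basis[OF B]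
    proof (rule measurable_measure_of)
      fix b assume "b \<in> B"
      then have "(\<lambda>\<omega>. \<omega> u) -` b \<inter> space ?N \<in> G"
        using that unfolding spN unfolding G_def by (auto intro!: image_eqI[of _ _ "(u, b)"])
      then show "(\<lambda>\<omega>. \<omega> u) -` b \<inter> space ?N \<in> sets ?N"
        unfolding setsN by (rule sigma_sets.Basic)
    qed auto
    have I_meas: "(\<lambda>\<omega>. \<omega> u) \<in> ?N \<rightarrow>\<^sub>M borel" if u: "u \<in> I" for u
    proof -
      obtain q :: "nat \<Rightarrow> 'i" where q: "range q \<subseteq> J" "\<And>\<omega>. \<omega> \<in> \<Omega> \<Longrightarrow> (\<lambda>n. \<omega> (q n)) \<longlonglongrightarrow> \<omega> u"
        using approx[OF u] by auto
      show ?thesis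
        by (rule borel_measurable_LIMSEQ_metric[where f="\<lambda>n \<omega>. \<omega> (q n)"])
           (use q spN J_meas in auto)
    qed
    have "(\<lambda>\<omega>. \<lambda>u\<in>I. \<omega> u) \<in> ?N \<rightarrow>\<^sub>M PiM I (\<lambda>_. borel)"
      by (rule measurable_restrict) (rule I_meas)
    then have "(\<lambda>\<omega>. \<omega>) \<in> ?N \<rightarrow>\<^sub>M PiM I (\<lambda>_. borel)"
      by (rule measurable_cong[THEN iffD1, rotated]) (use \<Omega> spN in \<open>auto simp: extensional_restrict\<close>)
    \<comment> \<open>The generated sigma-algebra measures every coordinate, hence the identity into
      the trace; its measurability is the remaining inclusion.\<close>
    then have id: "(\<lambda>\<omega>. \<omega>) \<in> ?N \<rightarrow>\<^sub>M ?M"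
      by (rule measurable_restrict_space2[rotated]) (simp add: spN)
    show "sets ?M \<subseteq> sigma_sets \<Omega> G"
    proof
      fix A assume A: "A \<in> sets ?M"
      then have "A \<subseteq> \<Omega>" using sets.sets_into_space sp by blast
      with measurable_sets[OF id A] show "A \<in> sigma_sets \<Omega> G"
        by (simp add: spN setsN Int_absorb2)
    qed
  qed
  ultimately show ?thesis
    using G by (auto simp: countably_generated_def sp)
qed

lemma sets_restrict_space_space: "sets (restrict_space M (space M)) = sets M"
proof
  show "sets (restrict_space M (space M)) \<subseteq> sets M"
    by (auto simp: sets_restrict_space_iff)
  show "sets M \<subseteq> sets (restrict_space M (space M))"
    by (auto simp: sets_restrict_space_iff sets.sets_into_space)
qed

lemma countably_generated_coords:
  "finite J \<Longrightarrow> countably_generated (coords J :: (nat \<Rightarrow> 'a::{second_countable_topology, metric_space}) measure)"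
proof -
  assume "finite J"
  then have "countably_generated (restrict_space (coords J) (space (coords J) :: (nat \<Rightarrow> 'a) set))"
    by (intro countably_generated_restrict_PiM[of _ _ J])
       (auto simp: space_PiM PiE_def countable_finite intro!: exI[of _ "\<lambda>_. _"])
  then show ?thesis
    by (simp add: countably_generated_def space_restrict_space sets_restrict_space_space)
qed

lemma cpaths_subset_space: "\<omega> \<in> cpaths T \<Longrightarrow> \<omega> \<in> space (PiM {0..T} (\<lambda>_. borel))"
  by (auto simp: cpaths_def space_PiM PiE_def)

lemma space_path_space: "space (path_space T) = cpaths T"
  using cpaths_subset_space by (auto simp: path_space_def space_restrict_space)

text \<open>A future path is the restriction of a continuous path on \<open>{0..T}\<close>, so
  countably many times determine the rest; \<open>0 \<le> s\<close> keeps these times inside the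
  interval of continuity.\<close>

lemma countably_generated_future_space:
  assumes "0 \<le> s"
  shows "countably_generated (future_space s T :: (real \<Rightarrow> 'a::{second_countable_topology, metric_space}) measure)"
  unfolding future_space_def
proof (rule countably_generated_restrict_PiM)
  \<comment> \<open>Times are approached from the right, which keeps them above \<open>s\<close>. No
    such sequence exists at the right end, so \<open>T\<close>, possibly irrational, is
    added.\<close>
  let ?J = "{s<..T} \<inter> (\<rat> \<union> {T})"
  show "countable ?J" by (intro countable_Int2 countable_Un countable_rat) auto
  fix u assume u: "u \<in> {s<..T}"
  obtain q :: "nat \<Rightarrow> real" where q: "range q \<subseteq> ?J" "q \<longlonglongrightarrow> u"
  proof (cases "u = T")
    case True
    show ?thesis by (rule that[of "\<lambda>_. T"]) (use u True in auto)
  next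
    case False
    with u have "u < T" by simp
    have "\<exists>x. x \<in> \<rat> \<and> u < x \<and> x < min T (u + 1 / real (Suc n))" for n
      using Rats_dense_in_real[of u "min T (u + 1 / real (Suc n))"] \<open>u < T\<close> by auto
    then obtain q where q: "\<And>n. q n \<in> \<rat>" "\<And>n. u < q n" "\<And>n. q n < min T (u + 1 / real (Suc n))"
      by metis
    have "q \<longlonglongrightarrow> u"
    proof (rule tendsto_sandwich[of "\<lambda>_. u" _ _ "\<lambda>n. u + 1 / real (Suc n)"])
      show "(\<lambda>n. u + 1 / real (Suc n)) \<longlonglongrightarrow> u"
        using tendsto_add[OF tendsto_const LIMSEQ_inverse_real_of_nat, of u] by (simp add: inverse_eq_divide)
    qed (use q in \<open>auto intro!: always_eventually less_imp_le\<close>)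
    moreover have "range q \<subseteq> ?J"
    proof safe
      fix n
      show "q n \<in> {s<..T}" using q(2,3)[of n] u by simp
    qed (use q(1) in blast)
    ultimately show ?thesis using that by blast
  qed
  have "(\<lambda>n. \<omega> (q n)) \<longlonglongrightarrow> \<omega> u" if \<omega>: "\<omega> \<in> (\<lambda>\<omega>. restrict \<omega> {s<..T}) ` cpaths T" for \<omega> :: "real \<Rightarrow> 'a"
  proof -
    obtain \<omega>' where \<omega>': "\<omega>' \<in> cpaths T" "\<omega> = restrict \<omega>' {s<..T}"
      using \<omega> by (elim imageE)
    have q_mem: "q n \<in> {s<..T}" for n using q(1) rangeI[of q n] by blast
    have "(\<lambda>n. \<omega>' (q n)) \<longlonglongrightarrow> \<omega>' u"
    proof (rule continuous_on_tendsto_compose[OF _ q(2)])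
      show "continuous_on {0..T} \<omega>'" using \<omega>'(1) by (simp add: cpaths_def)
      show "\<forall>\<^sub>F n in sequentially. q n \<in> {0..T}"
        using q_mem assms by (intro always_eventually) (auto intro: less_imp_le le_less_trans)
    qed (use u assms in auto)
    then show ?thesis using u \<omega>'(2) q_mem by simp
  qed
  with q(1) show "\<exists>q :: nat \<Rightarrow> real. range q \<subseteq> ?J \<and>
      (\<forall>\<omega>\<in>(\<lambda>\<omega>. restrict \<omega> {s<..T}) ` (cpaths T :: (real \<Rightarrow> 'a) set). (\<lambda>n. \<omega> (q n)) \<longlonglongrightarrow> \<omega> u)"
    by blast
qed auto

section \<open>Measurability of restrictions and grid projections\<close>

lemma restrict_measurable_path_space:
  assumes "s \<le> T"
  shows "(\<lambda>\<omega> :: real \<Rightarrow> 'a::topological_space. restrict \<omega> {0..s}) \<in> path_space T \<rightarrow>\<^sub>M path_space s"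
  unfolding path_space_def
proof (rule measurable_restrict_space2)
  show "(\<lambda>\<omega>. restrict \<omega> {0..s}) \<in> space (restrict_space (PiM {0..T} (\<lambda>_. borel)) (cpaths T :: (real \<Rightarrow> 'a) set)) \<rightarrow> cpaths s"
  proof
    fix \<omega> assume "\<omega> \<in> space (restrict_space (PiM {0..T} (\<lambda>_. borel)) (cpaths T :: (real \<Rightarrow> 'a) set))"
    then have "continuous_on {0..T} \<omega>" by (simp add: space_restrict_space cpaths_def)
    then have "continuous_on {0..s} \<omega>" by (rule continuous_on_subset) (use assms in auto)
    then have "continuous_on {0..s} (restrict \<omega> {0..s})" by (rule continuous_on_eq) simp
    then show "restrict \<omega> {0..s} \<in> cpaths s" by (simp add: cpaths_def)
  qed
qed (use assms in \<open>auto intro!: measurable_restrict_space1 measurable_restrict_subset\<close>)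

lemma restrict_measurable_future_space:
  assumes "0 \<le> s"
  shows "(\<lambda>\<omega>. restrict \<omega> {s<..T}) \<in> path_space T \<rightarrow>\<^sub>M future_space s T"
  unfolding path_space_def future_space_def
  by (rule measurable_restrict_space2)
     (use assms in \<open>auto simp: space_restrict_space intro!: measurable_restrict_space1 measurable_restrict_subset\<close>)

lemma grid_proj_measurable:
  assumes "t ` J \<subseteq> I"
  shows "grid_proj t J \<in> restrict_space (PiM I (\<lambda>_. borel)) \<Omega> \<rightarrow>\<^sub>M coords J"
proof -
  have "(\<lambda>\<omega>. \<lambda>j\<in>J. \<omega> (t j)) \<in> PiM I (\<lambda>_. borel) \<rightarrow>\<^sub>M coords J"
    using assms by (intro measurable_restrict measurable_component_singleton) auto
  then show ?thesis
    unfolding grid_proj_def[abs_def] by (rule measurable_restrict_space1)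
qed

text \<open>The event \<open>A\<close> is the trace of some \<open>A'\<close> in \<open>W\<close>,
  and the preimage of \<open>A'\<close> under the left inverse \<open>g\<close> is the required
  \<open>B\<close>. \<open>W\<close> may be larger than \<open>S\<close>: outside the range of
  \<open>Z\<close>, \<open>g\<close> may leave \<open>S\<close>.\<close>

lemma sets_vimage_left_inverse:
  assumes g: "g \<in> N \<rightarrow>\<^sub>M W" and Z: "Z \<in> space S \<rightarrow> space N" and inv: "\<And>\<omega>. \<omega> \<in> space S \<Longrightarrow> g (Z \<omega>) = \<omega>"
    and A: "A \<in> sets (restrict_space W (space S))"
  shows "\<exists>B\<in>sets N. A = Z -` B \<inter> space S"
proof -
  obtain A' where A': "A' \<in> sets W" "A = space S \<inter> A'"
    using A by (auto simp: sets_restrict_space)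
  show ?thesis
    by (rule bexI[OF _ measurable_sets[OF g A'(1)]]) (use A'(2) Z inv in auto)
qed

lemma sets_path_space_split:
  fixes A :: "(real \<Rightarrow> 'a::topological_space) set"
  assumes s: "0 \<le> s" "s \<le> T" and A: "A \<in> sets (path_space T)"
  shows "\<exists>B\<in>sets (path_space s \<Otimes>\<^sub>M future_space s T).
    A = (\<lambda>\<omega>. (restrict \<omega> {0..s}, restrict \<omega> {s<..T})) -` B \<inter> space (path_space T)"
proof (rule sets_vimage_left_inverse)
  let ?N = "path_space s \<Otimes>\<^sub>M future_space s T :: ((real \<Rightarrow> 'a) \<times> (real \<Rightarrow> 'a)) measure"
  have un: "{0..s} \<union> {s<..T} = {0..T}" using s by auto
  have "fst \<in> ?N \<rightarrow>\<^sub>M PiM {0..s} (\<lambda>_. borel)" "snd \<in> ?N \<rightarrow>\<^sub>M PiM {s<..T} (\<lambda>_. borel)"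
    using measurable_fst[of "path_space s" "future_space s T"] measurable_snd[of "path_space s" "future_space s T"]
    unfolding path_space_def future_space_def by (auto simp: measurable_restrict_space2_iff)
  then have "(\<lambda>z. (fst z, snd z)) \<in> ?N \<rightarrow>\<^sub>M PiM {0..s} (\<lambda>_. borel) \<Otimes>\<^sub>M PiM {s<..T} (\<lambda>_. borel)"
    by (rule measurable_Pair)
  from measurable_compose[OF this measurable_merge]
  \<comment> \<open>The target is the full product, not the path space: a past and a future chosen
    independently need not match at \<open>s\<close>, so the glued function may jump there.\<close>
  show "merge {0..s} {s<..T} \<in> ?N \<rightarrow>\<^sub>M PiM {0..T} (\<lambda>_. borel)"
    by (simp add: un)
  show "(\<lambda>\<omega>. (restrict \<omega> {0..s}, restrict \<omega> {s<..T})) \<in> space (path_space T) \<rightarrow> space ?N"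
    using measurable_space[OF restrict_measurable_path_space[OF s(2)]]
      measurable_space[OF restrict_measurable_future_space[OF s(1)]]
    by (auto simp: space_pair_measure)
  show "A \<in> sets (restrict_space (PiM {0..T} (\<lambda>_. borel)) (space (path_space T)))"
    using A unfolding space_path_space by (simp add: path_space_def)
  fix \<omega> :: "real \<Rightarrow> 'a" assume "\<omega> \<in> space (path_space T)"
  then have "\<omega> \<in> extensional {0..T}" by (simp add: space_path_space cpaths_def)
  then show "merge {0..s} {s<..T} (restrict \<omega> {0..s}, restrict \<omega> {s<..T}) = \<omega>"
    using s by (auto simp: merge_def fun_eq_iff extensional_def)
qed

lemma sets_coords_split:
  fixes A :: "(nat \<Rightarrow> 'a::topological_space) set"
  assumes i: "i \<le> N" and A: "A \<in> sets (coords {..N})"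
  shows "\<exists>B\<in>sets (coords {..i} \<Otimes>\<^sub>M coords {i<..N}).
    A = (\<lambda>z. (restrict z {..i}, restrict z {i<..N})) -` B \<inter> space (coords {..N})"
proof (rule sets_vimage_left_inverse)
  have "{..i} \<union> {i<..N} = {..N}" using i by auto
  then show "merge {..i} {i<..N} \<in> coords {..i} \<Otimes>\<^sub>M coords {i<..N} \<rightarrow>\<^sub>M coords {..N}"
    using measurable_merge[of "{..i}" "{i<..N}" "\<lambda>_. borel"] by simp
  show "(\<lambda>z. (restrict z {..i}, restrict z {i<..N})) \<in> space (coords {..N}) \<rightarrow> space (coords {..i} \<Otimes>\<^sub>M coords {i<..N})"
    by (auto simp: space_pair_measure space_PiM)
  show "A \<in> sets (restrict_space (coords {..N}) (space (coords {..N})))"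
    using A by (simp add: sets_restrict_space_iff sets.sets_into_space)
  fix z :: "nat \<Rightarrow> 'a" assume "z \<in> space (coords {..N})"
  then have "z \<in> extensional {..N}" by (simp add: space_PiM PiE_def)
  then show "merge {..i} {i<..N} (restrict z {..i}, restrict z {i<..N}) = z"
    using i by (auto simp: merge_def fun_eq_iff extensional_def)
qed

theorem proposition2:
  fixes N i :: nat and T :: real and t :: "nat \<Rightarrow> real"
    and R P :: "(real \<Rightarrow> real ^ 'd) measure"
    and \<mu> :: "(nat \<Rightarrow> real ^ 'd) measure"
    and P_fut :: "(real \<Rightarrow> real ^ 'd) \<Rightarrow> (real \<Rightarrow> real ^ 'd) measure"
    and R_fut :: "(nat \<Rightarrow> real ^ 'd) \<Rightarrow> (real \<Rightarrow> real ^ 'd) measure"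
    and \<mu>_fut :: "(nat \<Rightarrow> real ^ 'd) \<Rightarrow> (nat \<Rightarrow> real ^ 'd) measure"
  assumes grid: "t 0 = 0" "t N = T" "strict_mono_on {..N} t"
    and i: "i < N"
    and R: "R \<in> space (prob_algebra (path_space T))" "grid_compatible T t N R"
    and \<mu>: "\<mu> \<in> space (prob_algebra (coords {..N}))"
    and \<mu>_ac: "absolutely_continuous (distr R (coords {..N}) (grid_proj t {..N})) \<mu>"
    and \<mu>_fin: "rel_entropy \<mu> (distr R (coords {..N}) (grid_proj t {..N})) < \<infinity>"
    and P: "P \<in> space (prob_algebra (path_space T))"
           "distr P (coords {..N}) (grid_proj t {..N}) = \<mu>"
    and P_fut: "disintegrates P
                  (path_space (t i)) (\<lambda>\<omega>. restrict \<omega> {0..t i})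
                  (future_space (t i) T) (\<lambda>\<omega>. restrict \<omega> {t i<..T}) P_fut"
    and R_fut: "R_fut \<in> coords {..i} \<rightarrow>\<^sub>M prob_algebra (future_space (t i) T)"
               "disintegrates R
                  (path_space (t i)) (\<lambda>\<omega>. restrict \<omega> {0..t i})
                  (future_space (t i) T) (\<lambda>\<omega>. restrict \<omega> {t i<..T})
                  (\<lambda>\<omega>. R_fut (grid_proj t {..i} \<omega>))"
    and \<mu>_fut: "disintegrates \<mu>
                  (coords {..i}) (\<lambda>z. restrict z {..i})
                  (coords {i<..N}) (\<lambda>z. restrict z {i<..N}) \<mu>_fut"
  shows "minimises_entropy
           (laws_with_image (path_space T) (coords {..N}) (grid_proj t {..N}) \<mu>) R P
         \<longleftrightarrow>
         minimises_entropy
           (laws_with_image (path_space (t i)) (coords {..i}) (grid_proj t {..i})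
              (distr \<mu> (coords {..i}) (\<lambda>z. restrict z {..i})))
           (past_law (t i) R) (past_law (t i) P)
         \<and> (AE \<omega> in past_law (t i) P.
              minimises_entropy
                (laws_with_image (future_space (t i) T) (coords {i<..N}) (grid_proj t {i<..N})
                   (\<mu>_fut (grid_proj t {..i} \<omega>)))
                (R_fut (grid_proj t {..i} \<omega>)) (P_fut \<omega>))"
proof -
  have t_mono: "t j \<le> t k" if "j \<le> k" "k \<le> N" for j k
    using that grid(3) by (intro strict_mono_on_leD[OF grid(3)]) auto
  have t_less: "t i < t j" if "i < j" "j \<le> N" for j
    using that by (intro strict_mono_onD[OF grid(3)]) auto
  have ti: "0 \<le> t i" "t i \<le> T"
    using t_mono[of 0 i] t_mono[of i N] grid i by auto
  \<comment> \<open>The point \<open>t i\<close> itself counts to the closed past interval, later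
    grid points to the half-open future interval. This is why projection commutes with restriction,
    since a restricted path is \<open>undefined\<close> elsewhere.\<close>
  have t_past: "t j \<in> {0..t i}" if "j \<le> i" for j
    using t_mono[of 0 j] t_mono[of j i] grid i that by auto
  have t_fut: "t j \<in> {t i<..T}" if "i < j" "j \<le> N" for j
    using t_mono[of j N] t_less[of j] grid that by auto
  have t_all: "t j \<in> {0..T}" if "j \<le> N" for j
    using t_mono[of 0 j] t_mono[of j N] grid that by auto
  show ?thesis
    unfolding past_law_def
  proof (rule minimises_entropy_disintegration_iff[where E\<^sub>2="coords {i<..N}" and e\<^sub>2="\<lambda>z. restrict z {i<..N}"
        and Y="\<lambda>\<omega>. restrict \<omega> {t i<..T}"])
    show "(\<lambda>\<omega>. restrict \<omega> {0..t i}) \<in> path_space T \<rightarrow>\<^sub>M path_space (t i)"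
      by (rule restrict_measurable_path_space[OF ti(2)])
    show "(\<lambda>\<omega>. restrict \<omega> {t i<..T}) \<in> path_space T \<rightarrow>\<^sub>M future_space (t i) T"
      by (rule restrict_measurable_future_space[OF ti(1)])
    show "grid_proj t {..N} \<in> path_space T \<rightarrow>\<^sub>M coords {..N}"
      unfolding path_space_def by (intro grid_proj_measurable image_subsetI t_all) simp
    show "grid_proj t {..i} \<in> path_space (t i) \<rightarrow>\<^sub>M coords {..i}"
      unfolding path_space_def by (intro grid_proj_measurable image_subsetI t_past) simp
    show "grid_proj t {i<..N} \<in> future_space (t i) T \<rightarrow>\<^sub>M coords {i<..N}"
      unfolding future_space_def by (intro grid_proj_measurable image_subsetI t_fut) simp_all
    show "(\<lambda>z. restrict z {..i}) \<in> coords {..N} \<rightarrow>\<^sub>M coords {..i}"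
      using i by (intro measurable_restrict_subset) auto
    show "(\<lambda>z. restrict z {i<..N}) \<in> coords {..N} \<rightarrow>\<^sub>M coords {i<..N}"
      by (intro measurable_restrict_subset) auto
    show "restrict (grid_proj t {..N} \<omega>) {..i} = grid_proj t {..i} (restrict \<omega> {0..t i})" for \<omega> :: "real \<Rightarrow> real ^ 'd"
      using t_past i by (auto simp: grid_proj_def fun_eq_iff)
    show "restrict (grid_proj t {..N} \<omega>) {i<..N} = grid_proj t {i<..N} (restrict \<omega> {t i<..T})" for \<omega> :: "real \<Rightarrow> real ^ 'd"
      using t_fut by (auto simp: grid_proj_def fun_eq_iff)
    show "countably_generated (future_space (t i) T :: (real \<Rightarrow> real ^ 'd) measure)"
      by (rule countably_generated_future_space[OF ti(1)])
    show "countably_generated (coords {i<..N} :: (nat \<Rightarrow> real ^ 'd) measure)"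
      by (rule countably_generated_coords) simp
    show "\<exists>B\<in>sets (path_space (t i) \<Otimes>\<^sub>M future_space (t i) T).
        A = (\<lambda>\<omega>. (restrict \<omega> {0..t i}, restrict \<omega> {t i<..T})) -` B \<inter> space (path_space T)"
      if "A \<in> sets (path_space T)" for A :: "(real \<Rightarrow> real ^ 'd) set"
      using that by (rule sets_path_space_split[OF ti])
    show "\<exists>B\<in>sets (coords {..i} \<Otimes>\<^sub>M coords {i<..N}).
        A = (\<lambda>z. (restrict z {..i}, restrict z {i<..N})) -` B \<inter> space (coords {..N})"
      if "A \<in> sets (coords {..N})" for A :: "(nat \<Rightarrow> real ^ 'd) set"
      using that by (rule sets_coords_split[OF less_imp_le[OF i]])
  qed fact+
qed

end
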